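(* There exists an absolute constant $C>0$ such that the following holds. Let $M$ be an $m\times n$ real matrix of rank $r\geq1$ all of whose entries are non-negative and none of whose entries lie in the open interval $(0,1)$. If the average of the entries of $M$ is $\varepsilon\leq1/2$, then $M$ contains an all-zero submatrix with at least $2^{-C(\log_2 r+\sqrt{\varepsilon r})}m$ rows and at least $2^{-C(\log_2 r+\sqrt{\varepsilon r})}n$ columns.
   Context: A submatrix is obtained by selecting an arbitrary (not necessarily consecutive) set of rows and set of columns. *)

theory Defs
  imports
    Complex_Main
    "Jordan_Normal_Form.Matrix"
    "Jordan_Normal_Form.DL_Rank"
    "Jordan_Normal_Form.DL_Submatrix"
begin

definition mat_average :: "real mat \<Rightarrow> real" where
  "mat_average M =
     (\<Sum>i<dim_row M. \<Sum>j<dim_col M. M $$ (i, j)) / (real (dim_row M) * real (dim_col M))"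

end

(*
  Let F be the mean square of the entries.  Projecting the coordinate vectors onto the row space
  writes M i j = <u_i, v_j> with the average of |u_i|^2 times that of |v_j|^2 at most r F.  Hence,
  after discarding a few rows and columns, |u_i| |v_j| <= A = O(sqrt (r F)).  For a Gaussian vector
  g the functions (1 - c sin <u_i, g>) / 2 and (1 + c sin <v_j, g>) / 2 select a random rectangle
  containing (i, j) with probability exactly (1 - e^-1 sinh (M i j / A)) / 4.  Intersecting k
  independent copies keeps a 4^-k fraction of the zero entries but damps an entry x by a further
  factor exp (- k x / (3 A)).

  Since 0 < x < 1 is excluded, this can be iterated in three phases.  Discarding rows and columns
  alone bounds F by O(r).  Then F is brought down to O(eps) in log log r steps of total length
  O(sqrt (eps r)), while the density grows only by a constant factor.  Finally F decreases
  geometrically at cost O(sqrt (r F)) per step.  Once F <= 1 / (4 r), at least half of the rows have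
  few nonzero entries, and the columns vanishing on a basis of those rows vanish on all of them.
*)

theory Submission
  imports Defs "HOL-Probability.Probability"
begin

subsection \<open>Families of rectangles\<close>

text \<open>Costs are exponents: \<open>k\<close> copies cost \<open>2 * k\<close> bits of area, and
  an entry 1 is damped noticeably only once \<open>k\<close> is comparable with \<open>A\<close>.
  The obstacle is that the density does not control \<open>F\<close>: single entries may be
  arbitrarily large, so this price cannot be paid at the start. Discarding rows and columns loses
  only a small proportion and replaces \<open>F\<close> by \<open>A\<close> times the mean, a map of
  the form F -> O(sqrt (r F)) whose fixed point has order r. Below that, only \<open>k\<close> of
  order sqrt (eps r) is affordable. This already cuts the tail: entries beyond \<open>A / k\<close>
  are suppressed, and F becomes O(A eps / k), so F / eps is roughly replaced by its square root;
  hence log log r steps. In both phases the discarded proportions must be summable, so the induction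
  variable counts the steps still to go and the proportions shrink geometrically in it; the price is
  a growing loss per step, which a doubly exponential schedule absorbs. The area lost in these log
  log r steps, apart from the copies, is where log r enters the exponent.\<close>

text \<open>By duality this says that \<open>K\<close> is a mixture of indicators of rectangles; in this form no mixture has
  to be carried through products and expectations.\<close>

definition rect_dominated :: "'a set \<Rightarrow> 'b set \<Rightarrow> ('a \<Rightarrow> 'b \<Rightarrow> real) \<Rightarrow> bool" where
  "rect_dominated S T K \<longleftrightarrow>
     (\<forall>h. \<exists>X\<subseteq>S. \<exists>Y\<subseteq>T. (\<Sum>i\<in>S. \<Sum>j\<in>T. K i j * h i j) \<le> (\<Sum>i\<in>X. \<Sum>j\<in>Y. h i j))"

lemma sum_weight_le_subset:
  fixes c w :: "'a \<Rightarrow> real"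
  assumes "finite S" "\<And>i. i \<in> S \<Longrightarrow> 0 \<le> c i \<and> c i \<le> 1"
  shows "(\<Sum>i\<in>S. c i * w i) \<le> (\<Sum>i\<in>{i\<in>S. w i > 0}. w i)"
proof -
  have "(\<Sum>i\<in>S. c i * w i) \<le> (\<Sum>i\<in>S. if w i > 0 then w i else 0)"
  proof (rule sum_mono)
    fix i assume "i \<in> S"
    with assms(2) have "0 \<le> c i" "c i \<le> 1" by auto
    then show "c i * w i \<le> (if w i > 0 then w i else 0)"
      by (auto simp: mult_nonneg_nonpos mult_left_le_one_le)
  qed
  also have "\<dots> = (\<Sum>i\<in>{i\<in>S. w i > 0}. w i)"
    using assms(1) by (simp add: sum.inter_filter)
  finally show ?thesis .
qed

text \<open>A bilinear form in weights from [0, 1] is largest at 0/1 weights: \<open>\<phi>\<close>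
  is rounded with \<open>\<psi>\<close> fixed, then \<open>\<psi>\<close> against the rows already
  chosen.\<close>

lemma rect_dominated_tensor:
  fixes \<phi> :: "'a \<Rightarrow> real" and \<psi> :: "'b \<Rightarrow> real"
  assumes "finite S" "finite T"
    and \<phi>: "\<And>i. i \<in> S \<Longrightarrow> 0 \<le> \<phi> i \<and> \<phi> i \<le> 1"
    and \<psi>: "\<And>j. j \<in> T \<Longrightarrow> 0 \<le> \<psi> j \<and> \<psi> j \<le> 1"
  shows "rect_dominated S T (\<lambda>i j. \<phi> i * \<psi> j)"
  unfolding rect_dominated_def
proof
  fix h :: "'a \<Rightarrow> 'b \<Rightarrow> real"
  define X where "X = {i\<in>S. (\<Sum>j\<in>T. \<psi> j * h i j) > 0}"
  define Y where "Y = {j\<in>T. (\<Sum>i\<in>X. h i j) > 0}"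
  have "(\<Sum>i\<in>S. \<Sum>j\<in>T. \<phi> i * \<psi> j * h i j) = (\<Sum>i\<in>S. \<phi> i * (\<Sum>j\<in>T. \<psi> j * h i j))"
    by (simp add: sum_distrib_left mult.assoc)
  also have "\<dots> \<le> (\<Sum>i\<in>X. \<Sum>j\<in>T. \<psi> j * h i j)"
    unfolding X_def using assms by (intro sum_weight_le_subset)
  also have "\<dots> = (\<Sum>j\<in>T. \<psi> j * (\<Sum>i\<in>X. h i j))"
    by (subst sum.swap) (simp add: sum_distrib_left)
  also have "\<dots> \<le> (\<Sum>j\<in>Y. \<Sum>i\<in>X. h i j)"
    unfolding Y_def using assms by (intro sum_weight_le_subset)
  also have "\<dots> = (\<Sum>i\<in>X. \<Sum>j\<in>Y. h i j)"
    by (rule sum.swap)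
  finally show "\<exists>X\<subseteq>S. \<exists>Y\<subseteq>T. (\<Sum>i\<in>S. \<Sum>j\<in>T. \<phi> i * \<psi> j * h i j) \<le> (\<Sum>i\<in>X. \<Sum>j\<in>Y. h i j)"
    by (intro exI[of _ X] exI[of _ Y] conjI) (auto simp: X_def Y_def)
qed

text \<open>Products correspond to intersecting two independent rectangles: \<open>K\<close> is
  tested on \<open>L i j * h i j\<close>, then \<open>L\<close> on \<open>h\<close> cut off outside
  the rectangle found for \<open>K\<close>.\<close>

lemma rect_dominated_mult:
  assumes "finite S" "finite T" "rect_dominated S T K" "rect_dominated S T L"
  shows "rect_dominated S T (\<lambda>i j. K i j * L i j)"
  unfolding rect_dominated_def
proof
  fix h :: "'a \<Rightarrow> 'b \<Rightarrow> real"
  obtain X Y where XY: "X \<subseteq> S" "Y \<subseteq> T"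
    "(\<Sum>i\<in>S. \<Sum>j\<in>T. K i j * (L i j * h i j)) \<le> (\<Sum>i\<in>X. \<Sum>j\<in>Y. L i j * h i j)"
    using assms(3)[unfolded rect_dominated_def, rule_format, of "\<lambda>i j. L i j * h i j"] by blast
  define h' where "h' = (\<lambda>i j. if i \<in> X \<and> j \<in> Y then h i j else 0)"
  obtain X' Y' where XY': "X' \<subseteq> S" "Y' \<subseteq> T"
    "(\<Sum>i\<in>S. \<Sum>j\<in>T. L i j * h' i j) \<le> (\<Sum>i\<in>X'. \<Sum>j\<in>Y'. h' i j)"
    using assms(4)[unfolded rect_dominated_def, rule_format, of h'] by blast
  have fin: "finite X'" "finite Y'"
    using XY' assms finite_subset by blast+
  have restr: "(\<Sum>i\<in>A. \<Sum>j\<in>B. f i j * h' i j) = (\<Sum>i\<in>A \<inter> X. \<Sum>j\<in>B \<inter> Y. f i j * h i j)"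
    if "finite A" "finite B" for A B and f :: "'a \<Rightarrow> 'b \<Rightarrow> real"
  proof -
    have "(\<Sum>i\<in>A. \<Sum>j\<in>B. f i j * h' i j) =
        (\<Sum>i\<in>A. if i \<in> X then \<Sum>j\<in>B. if j \<in> Y then f i j * h i j else 0 else 0)"
      by (auto intro!: sum.cong simp: h'_def)
    then show ?thesis
      using that by (simp add: sum.inter_restrict)
  qed
  have "(\<Sum>i\<in>S. \<Sum>j\<in>T. K i j * L i j * h i j) \<le> (\<Sum>i\<in>X. \<Sum>j\<in>Y. L i j * h i j)"
    using XY by (simp add: mult.assoc)
  also have "\<dots> = (\<Sum>i\<in>S. \<Sum>j\<in>T. L i j * h' i j)"
    using restr[OF assms(1,2), of L] XY by (simp add: inf.absorb2)
  also have "\<dots> \<le> (\<Sum>i\<in>X' \<inter> X. \<Sum>j\<in>Y' \<inter> Y. h i j)"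
    using XY'(3) restr[OF fin, of "\<lambda>_ _. 1"] by simp
  finally show "\<exists>X\<subseteq>S. \<exists>Y\<subseteq>T. (\<Sum>i\<in>S. \<Sum>j\<in>T. K i j * L i j * h i j) \<le> (\<Sum>i\<in>X. \<Sum>j\<in>Y. h i j)"
    using XY by (intro exI[of _ "X' \<inter> X"] exI[of _ "Y' \<inter> Y"] conjI) auto
qed

lemma rect_dominated_power:
  assumes "finite S" "finite T" "rect_dominated S T K"
  shows "rect_dominated S T (\<lambda>i j. K i j ^ k)"
proof (induction k)
  case 0
  then show ?case
    unfolding rect_dominated_def by auto
next
  case (Suc k)
  then show ?case
    using rect_dominated_mult[OF assms(1,2,3) Suc] by simp
qed

text \<open>There are only finitely many rectangles, so for a fixed \<open>h\<close> one largest
  rectangle sum bounds the integrand at every point.\<close>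

lemma (in prob_space) rect_dominated_expectation:
  fixes K :: "'a \<Rightarrow> 'i \<Rightarrow> 'j \<Rightarrow> real"
  assumes "finite S" "finite T"
    and int: "\<And>i j. i \<in> S \<Longrightarrow> j \<in> T \<Longrightarrow> integrable M (\<lambda>\<omega>. K \<omega> i j)"
    and dom: "\<And>\<omega>. \<omega> \<in> space M \<Longrightarrow> rect_dominated S T (\<lambda>i j. K \<omega> i j)"
  shows "rect_dominated S T (\<lambda>i j. expectation (\<lambda>\<omega>. K \<omega> i j))"
  unfolding rect_dominated_def
proof
  fix h :: "'i \<Rightarrow> 'j \<Rightarrow> real"
  define R where "R = (\<lambda>(X, Y). \<Sum>i\<in>X. \<Sum>j\<in>Y. h i j) ` (Pow S \<times> Pow T)"
  have R: "finite R" "R \<noteq> {}"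
    using assms(1,2) by (auto simp: R_def)
  have le: "(\<Sum>i\<in>S. \<Sum>j\<in>T. K \<omega> i j * h i j) \<le> Max R" if \<omega>: "\<omega> \<in> space M" for \<omega>
  proof -
    obtain X Y where XY: "X \<subseteq> S" "Y \<subseteq> T"
      "(\<Sum>i\<in>S. \<Sum>j\<in>T. K \<omega> i j * h i j) \<le> (\<Sum>i\<in>X. \<Sum>j\<in>Y. h i j)"
      using dom[OF \<omega>, unfolded rect_dominated_def, rule_format, of h] by blast
    have "(\<Sum>i\<in>X. \<Sum>j\<in>Y. h i j) \<in> R"
      using XY by (auto simp: R_def intro!: image_eqI[of _ _ "(X, Y)"])
    with XY R show ?thesis
      by (meson Max_ge order_trans)
  qed
  have "(\<Sum>i\<in>S. \<Sum>j\<in>T. expectation (\<lambda>\<omega>. K \<omega> i j) * h i j) =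
      expectation (\<lambda>\<omega>. \<Sum>i\<in>S. \<Sum>j\<in>T. K \<omega> i j * h i j)"
    using int by (simp add: Bochner_Integration.integral_sum)
  also have "\<dots> \<le> expectation (\<lambda>\<omega>. Max R)"
    using int le by (intro integral_mono Bochner_Integration.integrable_sum) auto
  also have "\<dots> = Max R"
    by (simp add: prob_space)
  finally have *: "(\<Sum>i\<in>S. \<Sum>j\<in>T. expectation (\<lambda>\<omega>. K \<omega> i j) * h i j) \<le> Max R" .
  have "Max R \<in> R"
    using R by simp
  then obtain X Y where "X \<subseteq> S" "Y \<subseteq> T" "Max R = (\<Sum>i\<in>X. \<Sum>j\<in>Y. h i j)"
    by (auto simp: R_def)
  with * show "\<exists>X\<subseteq>S. \<exists>Y\<subseteq>T. (\<Sum>i\<in>S. \<Sum>j\<in>T. expectation (\<lambda>\<omega>. K \<omega> i j) * h i j) \<le> (\<Sum>i\<in>X. \<Sum>j\<in>Y. h i j)"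
    by auto
qed

subsection \<open>Gaussian rounding\<close>

abbreviation std_gaussian :: "'i set \<Rightarrow> ('i \<Rightarrow> real) measure" where
  "std_gaussian I \<equiv> Pi\<^sub>M I (\<lambda>_. std_normal_distribution)"

lemma prob_space_std_gaussian: "prob_space (std_gaussian I)"
  by (intro prob_space_PiM real_distribution.axioms(1) real_dist_normal_dist)

lemma measurable_linear_form [measurable]:
  assumes "finite I"
  shows "(\<lambda>g. \<Sum>l\<in>I. w l * g l) \<in> borel_measurable (std_gaussian I)"
proof (intro borel_measurable_sum borel_measurable_times borel_measurable_const)
  fix l assume "l \<in> I"
  then have "(\<lambda>g. g l) \<in> std_gaussian I \<rightarrow>\<^sub>M std_normal_distribution"
    by (rule measurable_component_singleton)
  then show "(\<lambda>g. g l) \<in> borel_measurable (std_gaussian I)"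
    by simp
qed

lemma char_std_gaussian:
  fixes w :: "'i \<Rightarrow> real"
  assumes "finite I"
  shows "(CLINT g|std_gaussian I. iexp (\<Sum>l\<in>I. w l * g l)) =
    complex_of_real (exp (- (\<Sum>l\<in>I. (w l)\<^sup>2) / 2))"
proof -
  interpret N: real_distribution std_normal_distribution
    by (rule real_dist_normal_dist)
  interpret product_sigma_finite "\<lambda>_::'i. std_normal_distribution"
    by standard
  have "(CLINT g|std_gaussian I. iexp (\<Sum>l\<in>I. w l * g l)) =
      (CLINT g|std_gaussian I. (\<Prod>l\<in>I. iexp (w l * g l)))"
    using assms by (simp add: exp_sum sum_distrib_left)
  also have "\<dots> = (\<Prod>l\<in>I. char std_normal_distribution (w l))"
    unfolding char_def using assms
    by (intro product_integral_prod N.integrable_const_bound[where B = 1]) auto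
  also have "\<dots> = complex_of_real (\<Prod>l\<in>I. exp (- (w l)\<^sup>2 / 2))"
    by (simp add: char_std_normal_distribution)
  also have "(\<Prod>l\<in>I. exp (- (w l)\<^sup>2 / 2)) = exp (- (\<Sum>l\<in>I. (w l)\<^sup>2) / 2)"
    using assms by (simp add: exp_sum[symmetric] sum_negf sum_divide_distrib)
  finally show ?thesis .
qed

lemma integral_cos_std_gaussian:
  assumes "finite I"
  shows "(LINT g|std_gaussian I. cos (\<Sum>l\<in>I. w l * g l)) = exp (- (\<Sum>l\<in>I. (w l)\<^sup>2) / 2)"
    and "(LINT g|std_gaussian I. sin (\<Sum>l\<in>I. w l * g l)) = 0"
proof -
  interpret prob_space "std_gaussian I" by (rule prob_space_std_gaussian)
  have int: "integrable (std_gaussian I) (\<lambda>g. iexp (\<Sum>l\<in>I. w l * g l))"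
    using assms by (intro integrable_const_bound[where B = 1]) auto
  show "(LINT g|std_gaussian I. cos (\<Sum>l\<in>I. w l * g l)) = exp (- (\<Sum>l\<in>I. (w l)\<^sup>2) / 2)"
    using integral_Re[OF int] char_std_gaussian[OF assms, of w] by (simp add: Re_exp)
  show "(LINT g|std_gaussian I. sin (\<Sum>l\<in>I. w l * g l)) = 0"
    using integral_Im[OF int] char_std_gaussian[OF assms, of w] by (simp add: Im_exp)
qed

text \<open>The product is half a difference of cosines, whose expectations see only the lengths of
  \<open>u - v\<close> and \<open>u + v\<close>; polarisation then leaves the inner product inside
  \<open>sinh\<close>.\<close>

lemma integral_sin_sin_std_gaussian:
  assumes "finite I"
  shows "(LINT g|std_gaussian I. sin (\<Sum>l\<in>I. u l * g l) * sin (\<Sum>l\<in>I. v l * g l)) =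
    exp (- ((\<Sum>l\<in>I. (u l)\<^sup>2) + (\<Sum>l\<in>I. (v l)\<^sup>2)) / 2) * sinh (\<Sum>l\<in>I. u l * v l)"
proof -
  interpret prob_space "std_gaussian I" by (rule prob_space_std_gaussian)
  have int: "integrable (std_gaussian I) (\<lambda>g. cos (\<Sum>l\<in>I. w l * g l))" for w
    using assms by (intro integrable_const_bound[where B = 1]) auto
  have eq: "sin (\<Sum>l\<in>I. u l * g l) * sin (\<Sum>l\<in>I. v l * g l) =
      (cos (\<Sum>l\<in>I. (u l - v l) * g l) - cos (\<Sum>l\<in>I. (u l + v l) * g l)) / 2" for g
    by (simp add: sin_times_sin left_diff_distrib distrib_right sum.distrib sum_subtractf)
  define s where "s = - ((\<Sum>l\<in>I. (u l)\<^sup>2) + (\<Sum>l\<in>I. (v l)\<^sup>2)) / 2"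
  define t where "t = (\<Sum>l\<in>I. u l * v l)"
  have "(\<Sum>l\<in>I. (u l - v l)\<^sup>2) = (\<Sum>l\<in>I. (u l)\<^sup>2) + (\<Sum>l\<in>I. (v l)\<^sup>2) - 2 * t"
    by (simp add: t_def power2_diff sum.distrib sum_subtractf sum_distrib_left mult.assoc)
  then have diff: "- (\<Sum>l\<in>I. (u l - v l)\<^sup>2) / 2 = s + t"
    by (simp add: s_def field_simps)
  have "(\<Sum>l\<in>I. (u l + v l)\<^sup>2) = (\<Sum>l\<in>I. (u l)\<^sup>2) + (\<Sum>l\<in>I. (v l)\<^sup>2) + 2 * t"
    by (simp add: t_def power2_sum sum.distrib sum_distrib_left mult.assoc)
  then have sum: "- (\<Sum>l\<in>I. (u l + v l)\<^sup>2) / 2 = s - t"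
    by (simp add: s_def field_simps)
  have "(LINT g|std_gaussian I. sin (\<Sum>l\<in>I. u l * g l) * sin (\<Sum>l\<in>I. v l * g l)) =
      (exp (- (\<Sum>l\<in>I. (u l - v l)\<^sup>2) / 2) - exp (- (\<Sum>l\<in>I. (u l + v l)\<^sup>2) / 2)) / 2"
    unfolding eq using int by (simp add: integral_cos_std_gaussian(1)[OF assms])
  also have "\<dots> = (exp (s + t) - exp (s - t)) / 2"
    unfolding diff sum ..
  also have "exp (s + t) = exp s * exp t"
    by (rule exp_add)
  also have "exp (s - t) = exp s * exp (- t)"
    using exp_add[of s "- t"] by simp
  also have "(exp s * exp t - exp s * exp (- t)) / 2 = exp s * sinh t"
    unfolding sinh_field_def by (simp add: right_diff_distrib)
  finally show ?thesis
    unfolding s_def t_def .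
qed

text \<open>The argument will be an inner product of vectors of length at most 1;
  \<open>exp (- 1)\<close> is the Gaussian damping of a pair of unit vectors.\<close>

definition rounding_kernel :: "real \<Rightarrow> real" where
  "rounding_kernel x = (1 - exp (- 1) * sinh x) / 4"

lemma rect_dominated_rounding_kernel:
  fixes u :: "'a \<Rightarrow> 'i \<Rightarrow> real" and v :: "'b \<Rightarrow> 'i \<Rightarrow> real"
  assumes "finite S" "finite T" "finite I"
    and u: "\<And>i. i \<in> S \<Longrightarrow> (\<Sum>l\<in>I. (u i l)\<^sup>2) \<le> 1"
    and v: "\<And>j. j \<in> T \<Longrightarrow> (\<Sum>l\<in>I. (v j l)\<^sup>2) \<le> 1"
  shows "rect_dominated S T (\<lambda>i j. rounding_kernel (\<Sum>l\<in>I. u i l * v j l))"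
proof -
  interpret prob_space "std_gaussian I" by (rule prob_space_std_gaussian)
  \<comment> \<open>Compensates for the Gaussian damping: with this factor every vector behaves as
    if it had length 1. The bound on the lengths gives \<open>c w \<le> 1\<close>, which keeps the
    weights in [0, 1].\<close>
  define c where "c = (\<lambda>w :: 'i \<Rightarrow> real. exp (((\<Sum>l\<in>I. (w l)\<^sup>2) - 1) / 2))"
  define s where "s = (\<lambda>(w :: 'i \<Rightarrow> real) g. sin (\<Sum>l\<in>I. w l * g l))"
  have meas [measurable]: "s w \<in> borel_measurable (std_gaussian I)" for w
    unfolding s_def using assms(3) by measurable
  have int: "integrable (std_gaussian I) (s w)"
    "integrable (std_gaussian I) (\<lambda>g. s w g * s w' g)" for w w'
    by (intro integrable_const_bound[where B = 1]; auto simp: s_def abs_mult mult_le_one)+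
  have unit: "0 \<le> (1 + a * s w g) / 2 \<and> (1 + a * s w g) / 2 \<le> 1" if "\<bar>a\<bar> \<le> 1" for a w g
  proof -
    have "\<bar>a * s w g\<bar> \<le> 1"
      unfolding s_def abs_mult using that by (intro mult_le_one) auto
    then show ?thesis by auto
  qed
  \<comment> \<open>The opposite signs make the covariance enter negatively, which favours zero
    entries; the two linear terms have expectation 0 because sine is odd.\<close>
  have expand: "(1 + (- a) * x) / 2 * ((1 + b * y) / 2) =
      1/4 - a / 4 * x + b / 4 * y - a * b / 4 * (x * y)" for a b x y :: real
    by (simp add: field_simps)
  have "rect_dominated S T (\<lambda>i j. expectation
      (\<lambda>g. (1 + (- c (u i)) * s (u i) g) / 2 * ((1 + c (v j) * s (v j) g) / 2)))"
  proof (rule rect_dominated_expectation)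
    show "integrable (std_gaussian I)
        (\<lambda>g. (1 + (- c (u i)) * s (u i) g) / 2 * ((1 + c (v j) * s (v j) g) / 2))" for i j
    proof -
      have "(\<lambda>g. (1 + (- c (u i)) * s (u i) g) / 2 * ((1 + c (v j) * s (v j) g) / 2)) =
         (\<lambda>g. 1/4 - c (u i) / 4 * s (u i) g + c (v j) / 4 * s (v j) g
           - c (u i) * c (v j) / 4 * (s (u i) g * s (v j) g))"
        by (simp only: expand)
      then show ?thesis using int by simp
    qed
    show "rect_dominated S T (\<lambda>i j. (1 + (- c (u i)) * s (u i) g) / 2 * ((1 + c (v j) * s (v j) g) / 2))" for g
      by (intro rect_dominated_tensor unit assms) (use u v in \<open>auto simp: c_def\<close>)
  qed (use assms in auto)
  also have "(\<lambda>i j. expectation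
      (\<lambda>g. (1 + (- c (u i)) * s (u i) g) / 2 * ((1 + c (v j) * s (v j) g) / 2))) =
      (\<lambda>i j. rounding_kernel (\<Sum>l\<in>I. u i l * v j l))"
  proof (intro ext)
    fix i j
    have "(\<lambda>g. (1 + (- c (u i)) * s (u i) g) / 2 * ((1 + c (v j) * s (v j) g) / 2)) =
         (\<lambda>g. 1/4 - c (u i) / 4 * s (u i) g + c (v j) / 4 * s (v j) g
           - c (u i) * c (v j) / 4 * (s (u i) g * s (v j) g))"
      by (simp only: expand)
    then have "expectation (\<lambda>g. (1 + (- c (u i)) * s (u i) g) / 2 * ((1 + c (v j) * s (v j) g) / 2)) =
        1/4 - c (u i) / 4 * expectation (s (u i)) + c (v j) / 4 * expectation (s (v j))
           - c (u i) * c (v j) / 4 * expectation (\<lambda>g. s (u i) g * s (v j) g)"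
      using int by (simp add: prob_space)
    also have "\<dots> = 1/4 - c (u i) * c (v j) / 4 *
        (exp (- ((\<Sum>l\<in>I. (u i l)\<^sup>2) + (\<Sum>l\<in>I. (v j l)\<^sup>2)) / 2) * sinh (\<Sum>l\<in>I. u i l * v j l))"
      unfolding s_def integral_cos_std_gaussian(2)[OF assms(3)] integral_sin_sin_std_gaussian[OF assms(3)]
      by simp
    also have "\<dots> = 1/4 - (c (u i) * c (v j) *
        exp (- ((\<Sum>l\<in>I. (u i l)\<^sup>2) + (\<Sum>l\<in>I. (v j l)\<^sup>2)) / 2)) * sinh (\<Sum>l\<in>I. u i l * v j l) / 4"
      by simp
    also have "c (u i) * c (v j) * exp (- ((\<Sum>l\<in>I. (u i l)\<^sup>2) + (\<Sum>l\<in>I. (v j l)\<^sup>2)) / 2) = exp (- 1)"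
      unfolding c_def exp_add[symmetric] by (simp add: field_simps)
    finally show "expectation (\<lambda>g. (1 + (- c (u i)) * s (u i) g) / 2 * ((1 + c (v j) * s (v j) g) / 2)) =
        rounding_kernel (\<Sum>l\<in>I. u i l * v j l)"
      unfolding rounding_kernel_def diff_divide_distrib .
  qed
  finally show ?thesis .
qed

lemma rounding_kernel_0 [simp]: "rounding_kernel 0 = 1 / 4"
  by (simp add: rounding_kernel_def)

lemma rounding_kernel_antimono: "x \<le> y \<Longrightarrow> rounding_kernel y \<le> rounding_kernel x"
  by (simp add: rounding_kernel_def)

lemma rounding_kernel_nonneg:
  assumes "x \<le> 1"
  shows "0 \<le> rounding_kernel x"
proof -
  have "exp (- 1) * sinh x \<le> exp (- 1) * sinh (1::real)"
    using assms by (intro mult_left_mono) auto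
  also have "\<dots> \<le> 1"
    by (simp add: sinh_field_def field_simps exp_minus)
  finally show ?thesis by (simp add: rounding_kernel_def)
qed

text \<open>The rate 1/3 comes from \<open>x \<le> sinh x\<close> and
  \<open>exp 1 \<le> 3\<close>.\<close>

lemma rounding_kernel_le:
  assumes "0 \<le> x"
  shows "rounding_kernel x \<le> exp (- x / 3) / 4"
proof -
  have "((\<lambda>t. sinh t - t) has_real_derivative cosh t - 1) (at t)" for t :: real
    by (auto intro!: derivative_eq_intros)
  then have "sinh 0 - 0 \<le> sinh x - x"
    using DERIV_nonneg_imp_nondecreasing[OF assms, of "\<lambda>t. sinh t - t"] cosh_real_ge_1
    by (metis diff_ge_0_iff_ge)
  then have "x \<le> sinh x"
    by simp
  moreover have "exp (-1) \<ge> (1/3::real)"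
    using exp_le by (simp add: exp_minus field_simps)
  ultimately have "x / 3 \<le> exp (- 1) * sinh x"
    using mult_mono[of "1/3" "exp (-1)" x "sinh x"] assms by simp
  moreover have "1 - x / 3 \<le> exp (- x / 3)"
    using exp_ge_add_one_self[of "- x / 3"] by simp
  ultimately show ?thesis by (simp add: rounding_kernel_def)
qed

subsection \<open>Matrices of low rank\<close>

text \<open>A factorisation of width \<open>r\<close> over index sets, rather than the rank of a
  matrix, so that the bound passes to arbitrary subrectangles without renumbering.\<close>

definition rank_le :: "nat \<Rightarrow> 'a set \<Rightarrow> 'b set \<Rightarrow> ('a \<Rightarrow> 'b \<Rightarrow> real) \<Rightarrow> bool" where
  "rank_le r X Y M \<longleftrightarrow> (\<exists>a b. \<forall>i\<in>X. \<forall>j\<in>Y. M i j = (\<Sum>k<r. a i k * b k j))"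

lemma rank_le_subset: "rank_le r X Y M \<Longrightarrow> X' \<subseteq> X \<Longrightarrow> Y' \<subseteq> Y \<Longrightarrow> rank_le r X' Y' M"
  unfolding rank_le_def by blast

text \<open>Gram-Schmidt, one vector at a time. Linear dependence shows as a vanishing residual
  \<open>g\<close>; then no new \<open>e\<close> is added and \<open>q\<close> falls behind
  \<open>r\<close>.\<close>

lemma gram_schmidt_finite:
  fixes b :: "nat \<Rightarrow> 'b \<Rightarrow> real"
  assumes "finite Y"
  shows "\<exists>q\<le>r. \<exists>e c. (\<forall>k<q. \<forall>l<q. (\<Sum>j\<in>Y. e k j * e l j) = (if k = l then 1 else 0)) \<and>
    (\<forall>k<r. \<forall>j\<in>Y. b k j = (\<Sum>l<q. c k l * e l j))"
proof (induction r)
  case 0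
  then show ?case by auto
next
  case (Suc r)
  then obtain q e c where q: "q \<le> r"
    and on: "\<And>k l. k < q \<Longrightarrow> l < q \<Longrightarrow> (\<Sum>j\<in>Y. e k j * e l j) = (if k = l then 1 else 0 :: real)"
    and c: "\<And>k j. k < r \<Longrightarrow> j \<in> Y \<Longrightarrow> b k j = (\<Sum>l<q. c k l * e l j)"
    by blast
  define d where "d l = (\<Sum>j\<in>Y. b r j * e l j)" for l
  define g where "g j = b r j - (\<Sum>l<q. d l * e l j)" for j
  define N where "N = (\<Sum>j\<in>Y. (g j)\<^sup>2)"
  have ge: "(\<Sum>j\<in>Y. g j * e l j) = 0" if "l < q" for l
  proof -
    have "(\<Sum>j\<in>Y. g j * e l j) = d l - (\<Sum>j\<in>Y. \<Sum>k<q. d k * (e k j * e l j))"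
      by (simp add: g_def d_def left_diff_distrib sum_subtractf sum_distrib_right mult.assoc)
    also have "(\<Sum>j\<in>Y. \<Sum>k<q. d k * (e k j * e l j)) = (\<Sum>k<q. d k * (\<Sum>j\<in>Y. e k j * e l j))"
      by (subst sum.swap) (simp add: sum_distrib_left)
    also have "\<dots> = (\<Sum>k<q. if k = l then d k else 0)"
      by (intro sum.cong) (auto simp: on that)
    also have "\<dots> = d l"
      using that by simp
    finally show ?thesis by simp
  qed
  show ?case
  proof (cases "N = 0")
    case True
    then have "g j = 0" if "j \<in> Y" for j
      using that assms by (simp add: N_def sum_nonneg_eq_0_iff)
    then have b: "b k j = (\<Sum>l<q. (c(r := d)) k l * e l j)" if "k < Suc r" "j \<in> Y" for k j
      using that c[of k j] by (cases "k = r") (auto simp: g_def)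
    show ?thesis
      by (rule exI[of _ q], intro conjI exI[of _ e] exI[of _ "c(r := d)"] allI impI ballI)
        (rule le_SucI q on b | assumption)+
  next
    case False
    then have N: "N > 0"
      unfolding N_def by (metis sum_nonneg zero_le_power2 order_le_imp_less_or_eq)
    define e' where "e' = e(q := (\<lambda>j. g j / sqrt N))"
    define c' where "c' = (\<lambda>k. if k = r then d(q := sqrt N) else (c k)(q := 0))"
    have gg: "(\<Sum>j\<in>Y. g j * g j) = N"
      by (simp add: N_def power2_eq_square)
    have ge': "(\<Sum>j\<in>Y. e l j * g j) = 0" if "l < q" for l
      using ge[OF that] by (simp add: mult.commute)
    have e'_simps: "e' q = (\<lambda>j. g j / sqrt N)" "\<And>l. l < q \<Longrightarrow> e' l = e l"
      by (auto simp: e'_def)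
    have on': "(\<Sum>j\<in>Y. e' k j * e' l j) = (if k = l then 1 else 0)" if kl: "k < Suc q" "l < Suc q" for k l
    proof -
      consider "k = q" "l = q" | "k = q" "l < q" | "k < q" "l = q" | "k < q" "l < q"
        using kl unfolding less_Suc_eq by blast
      then show ?thesis
      proof cases
        case 1
        have "(\<Sum>j\<in>Y. g j / sqrt N * (g j / sqrt N)) = (\<Sum>j\<in>Y. g j * g j) / N"
          using N by (simp add: sum_divide_distrib)
        with 1 gg N show ?thesis by (simp add: e'_simps)
      next
        case 2
        have "(\<Sum>j\<in>Y. g j / sqrt N * e l j) = (\<Sum>j\<in>Y. g j * e l j) / sqrt N"
          by (simp add: sum_divide_distrib)
        with 2 ge[of l] show ?thesis by (simp add: e'_simps)
      next
        case 3
        have "(\<Sum>j\<in>Y. e k j * (g j / sqrt N)) = (\<Sum>j\<in>Y. e k j * g j) / sqrt N"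
          by (simp add: sum_divide_distrib)
        with 3 ge'[of k] show ?thesis by (simp add: e'_simps)
      next
        case 4
        then show ?thesis by (simp add: e'_simps on)
      qed
    qed
    have b: "b k j = (\<Sum>l<Suc q. c' k l * e' l j)" if "k < Suc r" "j \<in> Y" for k j
    proof (cases "k = r")
      case True
      then show ?thesis
        using N by (simp add: c'_def e'_simps g_def)
    next
      case False
      then show ?thesis
        using that c[of k j] by (simp add: c'_def e'_simps)
    qed
    show ?thesis
      by (rule exI[of _ "Suc q"], intro conjI exI[of _ e'] exI[of _ c'] allI impI ballI)
        (rule Suc_le_mono[THEN iffD2] q on' b | assumption)+
  qed
qed

text \<open>The vectors \<open>w j\<close> are the projections of the coordinate vectors onto the row space, so the
  bound on their total length is the trace of that projection.\<close>

lemma rank_le_projection: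
  fixes M :: "'a \<Rightarrow> 'b \<Rightarrow> real"
  assumes "finite Y" "rank_le r X Y M"
  obtains w where "\<And>i j. i \<in> X \<Longrightarrow> j \<in> Y \<Longrightarrow> (\<Sum>l\<in>Y. M i l * w j l) = M i j"
    and "(\<Sum>j\<in>Y. \<Sum>l\<in>Y. (w j l)\<^sup>2) \<le> real r"
proof -
  obtain a b where ab: "\<And>i j. i \<in> X \<Longrightarrow> j \<in> Y \<Longrightarrow> M i j = (\<Sum>k<r. a i k * b k j)"
    using assms(2) unfolding rank_le_def by blast
  obtain q e c where q: "q \<le> r"
    and on: "\<And>k l. k < q \<Longrightarrow> l < q \<Longrightarrow> (\<Sum>j\<in>Y. e k j * e l j) = (if k = l then 1 else 0 :: real)"
    and c: "\<And>k j. k < r \<Longrightarrow> j \<in> Y \<Longrightarrow> b k j = (\<Sum>l<q. c k l * e l j)"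
    using gram_schmidt_finite[OF assms(1), of r b] by blast
  define d where "d i l = (\<Sum>k<r. a i k * c k l)" for i l
  define w where "w j l = (\<Sum>k<q. e k j * e k l)" for j l
  have row: "M i j = (\<Sum>l<q. d i l * e l j)" if "i \<in> X" "j \<in> Y" for i j
  proof -
    have "M i j = (\<Sum>k<r. \<Sum>l<q. a i k * c k l * e l j)"
      using that by (simp add: ab c sum_distrib_left mult.assoc)
    also have "\<dots> = (\<Sum>l<q. d i l * e l j)"
      by (subst sum.swap) (simp add: d_def sum_distrib_right)
    finally show ?thesis .
  qed
  \<comment> \<open>The vectors \<open>w j\<close> form the matrix of the orthogonal projection onto
    the span of the \<open>e k\<close>, which fixes every combination of them. This is used for the
    rows of \<open>M\<close> and for \<open>w j\<close> itself, where idempotence turns a squared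
    length into a diagonal entry.\<close>
  have inner: "(\<Sum>l\<in>Y. (\<Sum>k<q. f k * e k l) * w j l) = (\<Sum>k<q. f k * e k j)" for f j
  proof -
    have "(\<Sum>l\<in>Y. (\<Sum>k<q. f k * e k l) * w j l) =
        (\<Sum>l\<in>Y. \<Sum>k<q. \<Sum>k'<q. f k * e k' j * (e k l * e k' l))"
      unfolding w_def sum_product by (intro sum.cong refl) simp
    also have "\<dots> = (\<Sum>k<q. \<Sum>l\<in>Y. \<Sum>k'<q. f k * e k' j * (e k l * e k' l))"
      by (rule sum.swap)
    also have "\<dots> = (\<Sum>k<q. \<Sum>k'<q. \<Sum>l\<in>Y. f k * e k' j * (e k l * e k' l))"
      by (intro sum.cong refl sum.swap)
    also have "\<dots> = (\<Sum>k<q. \<Sum>k'<q. f k * e k' j * (\<Sum>l\<in>Y. e k l * e k' l))"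
      by (simp add: sum_distrib_left)
    also have "\<dots> = (\<Sum>k<q. \<Sum>k'<q. if k' = k then f k * e k' j else 0)"
      by (intro sum.cong) (auto simp: on)
    also have "\<dots> = (\<Sum>k<q. f k * e k j)"
      by simp
    finally show ?thesis .
  qed
  show thesis
  proof
    show "(\<Sum>l\<in>Y. M i l * w j l) = M i j" if "i \<in> X" "j \<in> Y" for i j
    proof -
      have "(\<Sum>l\<in>Y. M i l * w j l) = (\<Sum>l\<in>Y. (\<Sum>k<q. d i k * e k l) * w j l)"
        using that by (intro sum.cong) (simp_all add: row)
      then show ?thesis
        unfolding inner row[OF that] .
    qed
    have "(\<Sum>l\<in>Y. (w j l)\<^sup>2) = (\<Sum>k<q. e k j * e k j)" for j
      using inner[of "\<lambda>k. e k j" j, folded w_def]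
      unfolding power2_eq_square w_def[symmetric] .
    then have "(\<Sum>j\<in>Y. \<Sum>l\<in>Y. (w j l)\<^sup>2) = (\<Sum>k<q. \<Sum>j\<in>Y. e k j * e k j)"
      using sum.swap[of "\<lambda>j k. e k j * e k j" "{..<q}" Y] by simp
    also have "\<dots> = real q"
      by (simp add: on)
    finally show "(\<Sum>j\<in>Y. \<Sum>l\<in>Y. (w j l)\<^sup>2) \<le> real r"
      using q by simp
  qed
qed

text \<open>A row whose last coefficient is nonzero serves as a pivot: on the columns where that row
  vanishes, the last factor is a combination of the others. So the width drops by one at the price
  of at most \<open>t\<close> columns; the pivots play the role of a basis of the rows.\<close>

lemma rank_le_zero_columns:
  fixes M :: "'a \<Rightarrow> 'b \<Rightarrow> real"
  assumes "finite Y" "rank_le r X Y M" "\<And>i. i \<in> X \<Longrightarrow> card {j\<in>Y. M i j \<noteq> 0} \<le> t"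
  shows "\<exists>Y'\<subseteq>Y. card Y \<le> card Y' + r * t \<and> (\<forall>i\<in>X. \<forall>j\<in>Y'. M i j = 0)"
  using assms
proof (induction r arbitrary: Y)
  case 0
  then show ?case
    by (auto simp: rank_le_def)
next
  case (Suc r)
  obtain a b where ab: "\<And>i j. i \<in> X \<Longrightarrow> j \<in> Y \<Longrightarrow> M i j = (\<Sum>k<Suc r. a i k * b k j)"
    using Suc.prems(2) unfolding rank_le_def by blast
  show ?case
  proof (cases "\<forall>i\<in>X. a i r = 0")
    case True
    then have "rank_le r X Y M"
      using ab unfolding rank_le_def by (intro exI[of _ a] exI[of _ b]) auto
    then obtain Y' where "Y' \<subseteq> Y" "card Y \<le> card Y' + r * t" "\<forall>i\<in>X. \<forall>j\<in>Y'. M i j = 0"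
      using Suc.IH[OF Suc.prems(1) _ Suc.prems(3)] by blast
    then show ?thesis
      by (intro exI[of _ Y']) auto
  next
    case False
    then obtain i0 where i0: "i0 \<in> X" "a i0 r \<noteq> 0"
      by blast
    define Y1 where "Y1 = {j\<in>Y. M i0 j = 0}"
    have Y1: "Y1 \<subseteq> Y" "finite Y1"
      using Suc.prems(1) by (auto simp: Y1_def)
    have "M i j = (\<Sum>k<r. (a i k - a i r * a i0 k / a i0 r) * b k j)" if "i \<in> X" "j \<in> Y1" for i j
    proof -
      have j: "j \<in> Y" "M i0 j = 0"
        using that by (auto simp: Y1_def)
      have "a i0 r * b r j = - (\<Sum>k<r. a i0 k * b k j)"
        using ab[OF i0(1) j(1)] j(2) by simp
      then have "b r j = - (\<Sum>k<r. a i0 k * b k j) / a i0 r"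
        using i0 by (simp add: field_simps)
      then have "a i r * b r j = - (\<Sum>k<r. a i r * a i0 k / a i0 r * b k j)"
        by (simp add: sum_distrib_left sum_divide_distrib mult.assoc)
      then show ?thesis
        using ab[OF that(1) j(1)] by (simp add: left_diff_distrib sum_subtractf)
    qed
    then have "rank_le r X Y1 M"
      unfolding rank_le_def
      by (intro exI[of _ "\<lambda>i k. a i k - a i r * a i0 k / a i0 r"] exI[of _ b]) auto
    moreover have "card {j\<in>Y1. M i j \<noteq> 0} \<le> t" if "i \<in> X" for i
    proof -
      have "card {j\<in>Y1. M i j \<noteq> 0} \<le> card {j\<in>Y. M i j \<noteq> 0}"
        using Suc.prems(1) Y1 by (intro card_mono) auto
      then show ?thesis
        using Suc.prems(3)[OF that] by simp
    qed
    ultimately obtain Y' where Y': "Y' \<subseteq> Y1" "card Y1 \<le> card Y' + r * t"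
      "\<forall>i\<in>X. \<forall>j\<in>Y'. M i j = 0"
      using Suc.IH[OF Y1(2)] by blast
    have "Y = Y1 \<union> {j\<in>Y. M i0 j \<noteq> 0}"
      by (auto simp: Y1_def)
    then have "card Y \<le> card Y1 + card {j\<in>Y. M i0 j \<noteq> 0}"
      using card_Un_le by metis
    also have "\<dots> \<le> card Y' + r * t + t"
      using Y'(2) Suc.prems(3)[OF i0(1)] by simp
    finally show ?thesis
      using Y' Y1 by (intro exI[of _ Y']) auto
  qed
qed

section \<open>Very sparse matrices of low rank\<close>

lemma card_markov:
  fixes f :: "'a \<Rightarrow> real" and c \<delta> :: real
  assumes "finite X" "\<And>i. i \<in> X \<Longrightarrow> 0 \<le> f i" "0 < c" "(\<Sum>i\<in>X. f i) \<le> \<delta> * c * card X"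
  shows "(1 - \<delta>) * card X \<le> card {i\<in>X. f i \<le> c}"
proof -
  have "c * card {i\<in>X. c < f i} = (\<Sum>i\<in>{i\<in>X. c < f i}. c)"
    by simp
  also have "\<dots> \<le> (\<Sum>i\<in>{i\<in>X. c < f i}. f i)"
    by (intro sum_mono) auto
  also have "\<dots> \<le> (\<Sum>i\<in>X. f i)"
    using assms by (intro sum_mono2) auto
  also have "\<dots> \<le> c * (\<delta> * card X)"
    using assms(4) by (simp add: mult_ac)
  finally have "card {i\<in>X. c < f i} \<le> \<delta> * card X"
    using assms(3) by simp
  moreover have "card X = card {i\<in>X. f i \<le> c} + card {i\<in>X. c < f i}"
  proof -
    have "X = {i\<in>X. f i \<le> c} \<union> {i\<in>X. c < f i}"
      by auto
    then show ?thesis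
      using assms(1) by (subst (1) \<open>X = _\<close>, subst card_Un_disjoint) auto
  qed
  ultimately show ?thesis
    by (simp add: algebra_simps)
qed

lemma sparse_zero_submatrix:
  fixes M :: "'a \<Rightarrow> 'b \<Rightarrow> real"
  assumes "finite X" "finite Y" "rank_le r X Y M" "r \<ge> 1"
    and sparse: "(\<Sum>i\<in>X. real (card {j\<in>Y. M i j \<noteq> 0})) \<le> 1 / (4 * r) * (card X * card Y)"
  obtains X' Y' where "X' \<subseteq> X" "Y' \<subseteq> Y" "real (card X) / 2 \<le> card X'" "real (card Y) / 2 \<le> card Y'"
    "\<And>i j. i \<in> X' \<Longrightarrow> j \<in> Y' \<Longrightarrow> M i j = 0"
proof (cases "Y = {}")
  case True
  then show ?thesis
    using that[of X Y] by simp
next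
  case False
  \<comment> \<open>Rows have on average at most \<open>card Y / (4 * r)\<close> nonzero entries;
    twice that is the Markov threshold that keeps half of them. Rounding down loses nothing, as
    counts are integers, and \<open>r * t\<close> is at most half of \<open>card Y\<close>.\<close>
  define t where "t = card Y div (2 * r)"
  define X' where "X' = {i\<in>X. real (card {j\<in>Y. M i j \<noteq> 0}) \<le> card Y / (2 * r)}"
  have "(1 - 1/2) * card X \<le> card X'"
    unfolding X'_def
  proof (rule card_markov)
    show "0 < real (card Y) / real (2 * r)"
      using assms(2,4) False by (simp add: card_gt_0_iff)
    show "(\<Sum>i\<in>X. real (card {j\<in>Y. M i j \<noteq> 0})) \<le> 1 / 2 * (card Y / (2 * r)) * card X"
      using sparse by (simp add: mult.commute)
  qed (use assms in auto)
  then have X': "real (card X) / 2 \<le> card X'"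
    by simp
  have "card {j\<in>Y. M i j \<noteq> 0} \<le> t" if "i \<in> X'" for i
  proof -
    have "real (card {j\<in>Y. M i j \<noteq> 0}) \<le> card Y / (2 * r)"
      using that by (simp add: X'_def)
    then have "real (card {j\<in>Y. M i j \<noteq> 0} * (2 * r)) \<le> real (card Y)"
      using assms(4) by (simp add: pos_le_divide_eq)
    then have "card {j\<in>Y. M i j \<noteq> 0} * (2 * r) \<le> card Y"
      by (simp only: of_nat_le_iff)
    then show ?thesis
      using assms(4) unfolding t_def by (subst less_eq_div_iff_mult_less_eq) auto
  qed
  then obtain Y' where Y': "Y' \<subseteq> Y" "card Y \<le> card Y' + r * t" "\<forall>i\<in>X'. \<forall>j\<in>Y'. M i j = 0"
    using rank_le_zero_columns[OF assms(2) rank_le_subset[OF assms(3) _ subset_refl], of X' t]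
    unfolding X'_def by blast
  have "2 * (r * t) \<le> card Y"
    unfolding t_def using times_div_less_eq_dividend[of "2 * r" "card Y"] by (simp only: mult.assoc)
  with Y'(2) have "real (card Y) / 2 \<le> card Y'"
    by linarith
  moreover have "X' \<subseteq> X"
    unfolding X'_def by blast
  ultimately show ?thesis
    using that X' Y'(1,3) by blast
qed

section \<open>Translation to matrix rank and submatrices\<close>

text \<open>The rank is the size of a maximal independent set of columns. Maximality makes it span
  all columns, so its members form the left factor and the coordinates the right one.\<close>

lemma rank_le_matrix_rank:
  fixes M :: "real mat"
  assumes M: "M \<in> carrier_mat m n"
  shows "rank_le (vec_space.rank m M) {..<m} {..<n} (\<lambda>i j. M $$ (i, j))"
proof -
  interpret vec_space "TYPE(real)" m .
  obtain U where max: "maximal U (\<lambda>T. T \<subseteq> set (cols M) \<and> lin_indpt T)" and "finite U"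
    using maximal_exists_superset[of "set (cols M)" "\<lambda>T. T \<subseteq> set (cols M) \<and> lin_indpt T" "{}"]
    by (auto simp: finite_lin_indpt2)
  have U: "U \<subseteq> set (cols M)" "lin_indpt U"
    using max by (simp_all add: maximal_def)
  have cols: "set (cols M) \<subseteq> carrier_vec m"
    using M cols_dim by blast
  with U have U_carrier: "U \<subseteq> carrier_vec m"
    by blast
  have in_span: "v \<in> span U" if v: "v \<in> set (cols M)" for v
  proof (cases "v \<in> U")
    case True
    then show ?thesis
      using U_carrier in_own_span by auto
  next
    case False
    have "\<not> lin_indpt (U \<union> {v})"
    proof
      assume "lin_indpt (U \<union> {v})"
      with max v U(1) have "U \<union> {v} = U"
        unfolding maximal_def by (metis Un_subset_iff bot_least insert_subset sup_ge1)
      with False show False by blast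
    qed
    then show ?thesis
      using lin_dep_iff_in_span[of U v] U_carrier U(2) v cols False by auto
  qed
  obtain f where f: "bij_betw f {..<card U} U"
    using ex_bij_betw_nat_finite[OF \<open>finite U\<close>] by (auto simp: atLeast0LessThan)
  have "\<exists>c. col M j = lincomb c U" if "j < n" for j
  proof -
    have "col M j \<in> span U"
      using that M by (intro in_span) (auto simp: cols_def)
    then obtain a where "lincomb a U = col M j"
      using finite_in_span[OF \<open>finite U\<close>] U_carrier by auto
    then show ?thesis
      by (intro exI[of _ a]) simp
  qed
  then obtain c where c: "\<And>j. j < n \<Longrightarrow> col M j = lincomb (c j) U"
    by metis
  have "M $$ (i, j) = (\<Sum>k<card U. f k $ i * c j (f k))" if "i < m" "j < n" for i j
  proof -
    have "M $$ (i, j) = lincomb (c j) U $ i"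
      using c[OF that(2)] M that by (metis carrier_matD index_col)
    also have "\<dots> = (\<Sum>x\<in>U. c j x * x $ i)"
      using that U_carrier by (intro lincomb_index) auto
    also have "\<dots> = (\<Sum>k<card U. c j (f k) * f k $ i)"
      using sum.reindex_bij_betw[OF f, of "\<lambda>x. c j x * x $ i"] by simp
    finally show ?thesis
      by (simp add: mult.commute)
  qed
  then show ?thesis
    unfolding rank_card_indpt[OF M max] rank_le_def
    by (intro exI[of _ "\<lambda>i k. f k $ i"] exI[of _ "\<lambda>k j. c j (f k)"]) auto
qed

lemma submatrix_eq_zero:
  fixes M :: "real mat"
  assumes M: "M \<in> carrier_mat m n" and IJ: "I \<subseteq> {..<m}" "J \<subseteq> {..<n}"
    and zero: "\<And>i j. i \<in> I \<Longrightarrow> j \<in> J \<Longrightarrow> M $$ (i, j) = 0"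
  shows "submatrix M I J = 0\<^sub>m (card I) (card J)"
proof -
  have eq: "{i. i < dim_row M \<and> i \<in> I} = I" "{j. j < dim_col M \<and> j \<in> J} = J"
    using M IJ by auto
  show ?thesis
  proof (rule eq_matI)
    fix i j assume "i < dim_row (0\<^sub>m (card I) (card J) :: real mat)" "j < dim_col (0\<^sub>m (card I) (card J) :: real mat)"
    then have ij: "i < card I" "j < card J"
      by auto
    then have "pick I i \<in> I" "pick J j \<in> J"
      using pick_in_set by blast+
    with ij show "submatrix M I J $$ (i, j) = 0\<^sub>m (card I) (card J) $$ (i, j)"
      using submatrix_index[of i M I j J] by (simp add: eq zero)
  qed (simp_all add: dim_submatrix eq)
qed

subsection \<open>Passing to sparser submatrices\<close>

text \<open>Progress is measured by the product of the side lengths because a selected rectangle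
  comes with no control over its separate sides.\<close>

definition area :: "'a set \<Rightarrow> 'b set \<Rightarrow> real" where
  "area X Y = real (card X) * real (card Y)"

lemma area_nonneg [simp]: "0 \<le> area X Y"
  by (simp add: area_def)

lemma sqrt_ratio_product:
  fixes F n r \<delta> :: real
  assumes "0 < n" "0 < \<delta>" "0 \<le> F" "0 \<le> r"
  shows "sqrt (F * n / \<delta>) * sqrt (r / (n * \<delta>)) = sqrt (r * F) / \<delta>"
proof -
  have "sqrt (F * n / \<delta>) * sqrt (r / (n * \<delta>)) = sqrt (r * F / \<delta>\<^sup>2)"
    using assms by (simp add: real_sqrt_mult[symmetric] power2_eq_square field_simps)
  also have "\<dots> = sqrt (r * F) / \<delta>"
    using assms by (simp add: real_sqrt_divide)
  finally show ?thesis .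
qed

locale sparse_low_rank =
  fixes M :: "'a \<Rightarrow> 'b \<Rightarrow> real" and S :: "'a set" and T :: "'b set" and r :: nat
  assumes fin: "finite S" "finite T"
    and rank: "rank_le r S T M" and r_pos: "r \<ge> 1"
    and entries: "\<And>i j. i \<in> S \<Longrightarrow> j \<in> T \<Longrightarrow> M i j = 0 \<or> M i j \<ge> 1"
begin

definition block :: "(real \<Rightarrow> real) \<Rightarrow> 'a set \<Rightarrow> 'b set \<Rightarrow> real" where
  "block f X Y = (\<Sum>i\<in>X. \<Sum>j\<in>Y. f (M i j))"

lemma entry_nonneg: "i \<in> S \<Longrightarrow> j \<in> T \<Longrightarrow> 0 \<le> M i j"
  using entries[of i j] by auto

lemma block_const: "block (\<lambda>x. c) X Y = c * area X Y"
  by (simp add: block_def area_def)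

lemma block_diff: "block (\<lambda>x. f x - g x) X Y = block f X Y - block g X Y"
  by (simp add: block_def sum_subtractf)

lemma block_cmult: "block (\<lambda>x. c * f x) X Y = c * block f X Y"
  by (simp add: block_def sum_distrib_left)

lemma block_mono:
  assumes "X \<subseteq> S" "Y \<subseteq> T" "\<And>x. x = 0 \<or> x \<ge> 1 \<Longrightarrow> f x \<le> g x"
  shows "block f X Y \<le> block g X Y"
  unfolding block_def using assms entries by (intro sum_mono) blast

lemma block_nonneg:
  assumes "X \<subseteq> S" "Y \<subseteq> T" "\<And>x. x = 0 \<or> x \<ge> 1 \<Longrightarrow> 0 \<le> f x"
  shows "0 \<le> block f X Y"
  unfolding block_def using assms entries by (intro sum_nonneg) blast

lemma block_subset_mono:
  assumes "X \<subseteq> S" "Y \<subseteq> T" "X' \<subseteq> X" "Y' \<subseteq> Y" "\<And>x. x = 0 \<or> x \<ge> 1 \<Longrightarrow> 0 \<le> f x"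
  shows "block f X' Y' \<le> block f X Y"
proof -
  have nonneg: "0 \<le> f (M i j)" if "i \<in> X" "j \<in> Y" for i j
    using assms(1,2,5) entries[of i j] that by blast
  have finXY: "finite X" "finite Y"
    using assms(1,2) fin finite_subset by blast+
  have "block f X' Y' \<le> (\<Sum>i\<in>X'. \<Sum>j\<in>Y. f (M i j))"
    unfolding block_def using assms(3,4) nonneg finXY by (intro sum_mono sum_mono2) auto
  also have "\<dots> \<le> block f X Y"
    unfolding block_def using assms(3) nonneg finXY by (intro sum_mono2 sum_nonneg) auto
  finally show ?thesis .
qed

text \<open>The rows have mean squared length at most \<open>F * n\<close>, the projected vectors
  \<open>w j\<close> at most \<open>r / n\<close>. Markov's inequality at
  \<open>1 / \<delta>\<close> times these means discards a proportion \<open>\<delta>\<close> on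
  each side; scaling by \<open>sqrt a\<close> and \<open>sqrt b\<close> puts the survivors into the
  unit ball, with inner products \<open>M i j / A\<close>.\<close>

lemma trim:
  fixes F \<delta> :: real
  assumes XY: "X \<subseteq> S" "Y \<subseteq> T" and F: "0 < F" and \<delta>: "0 < \<delta>" "\<delta> < 1"
    and sq: "block (\<lambda>x. x\<^sup>2) X Y \<le> F * area X Y"
  obtains X' Y' where "X' \<subseteq> X" "Y' \<subseteq> Y" "(1 - \<delta>)\<^sup>2 * area X Y \<le> area X' Y'"
    and "\<And>i j. i \<in> X' \<Longrightarrow> j \<in> Y' \<Longrightarrow> M i j \<le> sqrt (r * F) / \<delta>"
    and "rect_dominated X' Y' (\<lambda>i j. rounding_kernel (M i j / (sqrt (r * F) / \<delta>)))"
proof (cases "Y = {}")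
  case True
  then show ?thesis
    by (intro that[of "{}" "{}"]) (auto simp: area_def rect_dominated_def)
next
  case False
  have finXY: "finite X" "finite Y"
    using XY fin finite_subset by blast+
  define n where "n = real (card Y)"
  have n: "n > 0"
    using False finXY by (simp add: n_def card_gt_0_iff)
  obtain w where w: "\<And>i j. i \<in> X \<Longrightarrow> j \<in> Y \<Longrightarrow> (\<Sum>l\<in>Y. M i l * w j l) = M i j"
    and tr: "(\<Sum>j\<in>Y. \<Sum>l\<in>Y. (w j l)\<^sup>2) \<le> real r"
    using rank_le_projection[OF finXY(2) rank_le_subset[OF rank XY]] by blast
  define a b where "a = F * n / \<delta>" and "b = r / (n * \<delta>)"
  have ab: "0 < a" "0 < b"
    using F n \<delta> r_pos by (simp_all add: a_def b_def)
  define A where "A = sqrt (r * F) / \<delta>"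
  have A: "sqrt a * sqrt b = A"
    unfolding a_def b_def A_def using F n \<delta> by (intro sqrt_ratio_product) auto
  define X' where "X' = {i\<in>X. (\<Sum>l\<in>Y. (M i l)\<^sup>2) \<le> a}"
  define Y' where "Y' = {j\<in>Y. (\<Sum>l\<in>Y. (w j l)\<^sup>2) \<le> b}"
  have "\<delta> * a * card X = F * area X Y"
    using \<delta> by (simp add: a_def area_def n_def)
  then have X': "(1 - \<delta>) * card X \<le> card X'"
    unfolding X'_def using sq ab finXY by (intro card_markov) (auto simp: block_def intro: sum_nonneg)
  have "\<delta> * b * card Y = r"
    using \<delta> n by (simp add: b_def n_def)
  then have Y': "(1 - \<delta>) * card Y \<le> card Y'"
    unfolding Y'_def using tr ab finXY by (intro card_markov) (auto intro: sum_nonneg)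
  have sub: "X' \<subseteq> X" "Y' \<subseteq> Y"
    by (auto simp: X'_def Y'_def)
  \<comment> \<open>Coordinates still run over all of \<open>Y\<close>, not \<open>Y'\<close>: the
    identity that recovers \<open>M i j\<close> needs every coordinate, including those of discarded
    columns.\<close>
  define u where "u i l = M i l / sqrt a" for i l
  define v where "v j l = w j l / sqrt b" for j l
  have u: "(\<Sum>l\<in>Y. (u i l)\<^sup>2) \<le> 1" if "i \<in> X'" for i
  proof -
    have "(\<Sum>l\<in>Y. (u i l)\<^sup>2) = (\<Sum>l\<in>Y. (M i l)\<^sup>2) / a"
      using ab by (simp add: u_def power_divide sum_divide_distrib)
    then show ?thesis
      using that ab by (simp add: X'_def)
  qed
  have v: "(\<Sum>l\<in>Y. (v j l)\<^sup>2) \<le> 1" if "j \<in> Y'" for j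
  proof -
    have "(\<Sum>l\<in>Y. (v j l)\<^sup>2) = (\<Sum>l\<in>Y. (w j l)\<^sup>2) / b"
      using ab by (simp add: v_def power_divide sum_divide_distrib)
    then show ?thesis
      using that ab by (simp add: Y'_def)
  qed
  have uv: "(\<Sum>l\<in>Y. u i l * v j l) = M i j / A" if "i \<in> X'" "j \<in> Y'" for i j
  proof -
    have "(\<Sum>l\<in>Y. u i l * v j l) = (\<Sum>l\<in>Y. M i l * w j l) / (sqrt a * sqrt b)"
      by (simp add: u_def v_def sum_divide_distrib)
    also have "\<dots> = M i j / A"
      using w[of i j] sub that A by auto
    finally show ?thesis .
  qed
  have A_pos: "A > 0"
    using ab A by (metis mult_pos_pos real_sqrt_gt_zero)
  have le: "M i j \<le> A" if "i \<in> X'" "j \<in> Y'" for i j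
  proof -
    have "M i j / A \<le> (\<Sum>l\<in>Y. ((u i l)\<^sup>2 + (v j l)\<^sup>2) / 2)"
      unfolding uv[OF that, symmetric]
    proof (intro sum_mono)
      fix l
      show "u i l * v j l \<le> ((u i l)\<^sup>2 + (v j l)\<^sup>2) / 2"
        using zero_le_power2[of "u i l - v j l"] unfolding power2_diff by simp
    qed
    also have "\<dots> = ((\<Sum>l\<in>Y. (u i l)\<^sup>2) + (\<Sum>l\<in>Y. (v j l)\<^sup>2)) / 2"
      by (simp add: sum.distrib sum_divide_distrib[symmetric])
    also have "\<dots> \<le> 1"
      using u[OF that(1)] v[OF that(2)] by simp
    finally show ?thesis
      using A_pos by simp
  qed
  have "rect_dominated X' Y' (\<lambda>i j. rounding_kernel (\<Sum>l\<in>Y. u i l * v j l))"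
    using finXY sub u v by (intro rect_dominated_rounding_kernel) (auto intro: finite_subset)
  then have dom: "rect_dominated X' Y' (\<lambda>i j. rounding_kernel (M i j / A))"
    unfolding rect_dominated_def by (simp add: uv cong: sum.cong)
  have "(1 - \<delta>)\<^sup>2 * area X Y = ((1 - \<delta>) * card X) * ((1 - \<delta>) * card Y)"
    by (simp add: area_def power2_eq_square)
  also have "\<dots> \<le> area X' Y'"
    unfolding area_def using X' Y' \<delta> by (intro mult_mono) auto
  finally show ?thesis
    using that[OF sub] le dom unfolding A_def by blast
qed

lemma kernel_power_bounds:
  fixes A x :: real
  assumes "0 < A" "0 \<le> x" "x \<le> A"
  shows "0 \<le> rounding_kernel (x / A) ^ k"
    and "rounding_kernel (x / A) ^ k \<le> (1 / 4) ^ k * exp (- (k * x / (3 * A)))"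
proof -
  have "x / A \<le> 1"
    using assms by simp
  then have nonneg: "0 \<le> rounding_kernel (x / A)"
    by (rule rounding_kernel_nonneg)
  then show "0 \<le> rounding_kernel (x / A) ^ k"
    by simp
  have "rounding_kernel (x / A) ^ k \<le> (exp (- (x / A) / 3) / 4) ^ k"
    using assms nonneg by (intro power_mono rounding_kernel_le) auto
  also have "\<dots> = (1 / 4) ^ k * exp (- (k * x / (3 * A)))"
    by (simp add: power_divide exp_of_nat_mult[symmetric])
  finally show "rounding_kernel (x / A) ^ k \<le> (1 / 4) ^ k * exp (- (k * x / (3 * A)))" .
qed

text \<open>Reduces selection to a pointwise inequality in the entry value. All demands on the
  rectangle are packed into one \<open>h\<close>, namely 1 minus nonnegative penalties, so a single
  lower bound on its sum bounds the area from below and each penalty by the area.\<close>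

lemma block_select:
  assumes XY: "X \<subseteq> S" "Y \<subseteq> T" and A: "0 < A"
    and le: "\<And>i j. i \<in> X \<Longrightarrow> j \<in> Y \<Longrightarrow> M i j \<le> A"
    and dom: "rect_dominated X Y (\<lambda>i j. rounding_kernel (M i j / A))"
    and lower: "\<And>x. x = 0 \<or> x \<ge> 1 \<Longrightarrow> x \<le> A \<Longrightarrow> f x \<le> rounding_kernel (x / A) ^ k * h x"
  obtains X' Y' where "X' \<subseteq> X" "Y' \<subseteq> Y" "block f X Y \<le> block h X' Y'"
proof -
  have finXY: "finite X" "finite Y"
    using XY fin finite_subset by blast+
  have "rect_dominated X Y (\<lambda>i j. rounding_kernel (M i j / A) ^ k)"
    by (rule rect_dominated_power[OF finXY dom])
  from this[unfolded rect_dominated_def, rule_format, of "\<lambda>i j. h (M i j)"] obtain X' Y' where X'Y': "X' \<subseteq> X" "Y' \<subseteq> Y"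
    "(\<Sum>i\<in>X. \<Sum>j\<in>Y. rounding_kernel (M i j / A) ^ k * h (M i j)) \<le> (\<Sum>i\<in>X'. \<Sum>j\<in>Y'. h (M i j))"
    by blast
  have "block f X Y \<le> (\<Sum>i\<in>X. \<Sum>j\<in>Y. rounding_kernel (M i j / A) ^ k * h (M i j))"
    unfolding block_def
  proof (intro sum_mono)
    fix i j assume "i \<in> X" "j \<in> Y"
    then show "f (M i j) \<le> rounding_kernel (M i j / A) ^ k * h (M i j)"
      using XY by (intro lower entries le) auto
  qed
  also have "\<dots> \<le> block h X' Y'"
    unfolding block_def by fact
  finally show ?thesis
    using that X'Y'(1,2) by blast
qed

text \<open>Weighting by a kernel that decreases in the entry does not increase the mean (Chebyshev's sum
  inequality), so the density grows only by the factor \<open>1 / (1 - \<delta>)\<close>; the second moment drops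
  because \<open>x\<^sup>2 exp (- s x) \<le> x / s\<close>.\<close>

lemma select_middle:
  assumes XY: "X \<subseteq> S" "Y \<subseteq> T" and A: "0 < A"
    and le: "\<And>i j. i \<in> X \<Longrightarrow> j \<in> Y \<Longrightarrow> M i j \<le> A"
    and dom: "rect_dominated X Y (\<lambda>i j. rounding_kernel (M i j / A))"
    and p: "0 < p" "p \<le> 3 / 4" "block (\<lambda>x. x) X Y \<le> p * area X Y"
    and \<delta>: "0 < \<delta>" "\<delta> < 1" and k: "k \<ge> 1"
  obtains X' Y' where "X' \<subseteq> X" "Y' \<subseteq> Y" "\<delta> / 8 * (1 / 4) ^ k * area X Y \<le> area X' Y'"
    and "block (\<lambda>x. x) X' Y' \<le> p / (1 - \<delta>) * area X' Y'"
    and "block (\<lambda>x. x\<^sup>2) X' Y' \<le> 24 * A * p / (\<delta> * k) * area X' Y'"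
proof -
  define q where "q = (1 / 4 :: real) ^ k"
  \<comment> \<open>The kernel at \<open>p\<close>, the pivot of Chebyshev's inequality;
    \<open>min\<close> keeps the argument where the kernel is known to be nonnegative.\<close>
  define c where "c = rounding_kernel (min (p / A) 1) ^ k"
  \<comment> \<open>Chosen so that the second-moment penalty costs at most
    \<open>\<delta> * q / 8\<close> of the area. The share \<open>\<delta>\<close> of the kernel
    contributes at least \<open>\<delta> * q * (1 - 3 / 4)\<close>, the share
    \<open>1 - \<delta>\<close> at least 0 on average, so \<open>\<delta> * q / 8\<close>
    remains.\<close>
  define \<beta> where "\<beta> = \<delta> * k / (24 * A * p)"
  define h where "h x = 1 - (1 - \<delta>) / p * x - \<beta> * x\<^sup>2" for x
  define f where "f x = (\<delta> * q + (1 - \<delta>) * c) - (\<delta> * q + (1 - \<delta>) * c / p + q * \<delta> / (8 * p)) * x" for x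
  have q: "q > 0"
    by (simp add: q_def)
  have c: "c \<ge> 0"
    unfolding c_def by (intro zero_le_power rounding_kernel_nonneg) simp
  have \<beta>: "\<beta> > 0"
    using \<delta> k A p by (simp add: \<beta>_def)
  have "f x \<le> rounding_kernel (x / A) ^ k * h x" if x: "x = 0 \<or> x \<ge> 1" "x \<le> A" for x
  proof -
    define K where "K = rounding_kernel (x / A) ^ k"
    have x0: "0 \<le> x"
      using x by auto
    have K: "0 \<le> K" "K \<le> q * exp (- (k * x / (3 * A)))"
      using kernel_power_bounds[OF A x0 x(2), of k] by (simp_all add: K_def q_def)
    \<comment> \<open>Here the gap is used: at a nonzero entry the left side is at most 0.\<close>
    have 1: "q * (1 - x) \<le> K"
    proof (cases "x = 0")
      case True
      then show ?thesis by (simp add: K_def q_def)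
    next
      case False
      then have "q * (1 - x) \<le> 0"
        using x q by (auto intro: mult_nonneg_nonpos)
      with K show ?thesis by simp
    qed
    \<comment> \<open>On either side of \<open>p\<close>, the factors \<open>K - c\<close> and
      \<open>1 - x / p\<close> have the same sign.\<close>
    have 2: "c * (1 - x / p) \<le> K * (1 - x / p)"
    proof (cases "x \<le> p")
      case True
      have "x / A \<le> min (p / A) 1"
        using A x True by (simp add: divide_right_mono)
      then have "c \<le> K"
        unfolding c_def K_def by (intro power_mono rounding_kernel_antimono rounding_kernel_nonneg) auto
      then show ?thesis
        using True p by (intro mult_right_mono) auto
    next
      case False
      have "min (p / A) 1 \<le> x / A"
        using A False by (simp add: min_le_iff_disj divide_right_mono)
      then have "K \<le> c"
        unfolding c_def K_def using A x
        by (intro power_mono rounding_kernel_antimono rounding_kernel_nonneg) auto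
      then show ?thesis
        using False p by (intro mult_right_mono_neg) auto
    qed
    have 3: "K * x\<^sup>2 \<le> q * (3 * A / k) * x"
    proof -
      define s where "s = k / (3 * A)"
      have s: "s > 0"
        using A k by (simp add: s_def)
      have "s * x \<le> exp (s * x)"
        using exp_ge_add_one_self[of "s * x"] by linarith
      then have "x * exp (- (s * x)) \<le> 1 / s"
        using s by (simp add: exp_minus field_simps)
      then have "q * x * (x * exp (- (s * x))) \<le> q * x * (1 / s)"
        using q x0 by (intro mult_left_mono) auto
      moreover have "K * x\<^sup>2 \<le> q * exp (- (s * x)) * x\<^sup>2"
        using K(2) by (intro mult_right_mono) (auto simp: s_def)
      ultimately show ?thesis
        by (simp add: power2_eq_square mult_ac s_def)
    qed
    have "\<beta> * (q * (3 * A / k) * x) = q * \<delta> / (8 * p) * x"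
      using A k p by (simp add: \<beta>_def field_simps)
    moreover have "\<beta> * (K * x\<^sup>2) \<le> \<beta> * (q * (3 * A / k) * x)"
      using 3 \<beta> by (intro mult_left_mono) auto
    moreover have "\<delta> * (q * (1 - x)) \<le> \<delta> * K"
      using 1 \<delta> by (intro mult_left_mono) auto
    moreover have "(1 - \<delta>) * (c * (1 - x / p)) \<le> (1 - \<delta>) * (K * (1 - x / p))"
      using 2 \<delta> by (intro mult_left_mono) auto
    moreover have "K * h x = \<delta> * K + (1 - \<delta>) * (K * (1 - x / p)) - \<beta> * (K * x\<^sup>2)"
      by (simp add: h_def algebra_simps)
    moreover have "f x = \<delta> * (q * (1 - x)) + (1 - \<delta>) * (c * (1 - x / p)) - q * \<delta> / (8 * p) * x"
      by (simp add: f_def algebra_simps)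
    ultimately show ?thesis
      unfolding K_def[symmetric] by linarith
  qed
  then obtain X' Y' where X'Y': "X' \<subseteq> X" "Y' \<subseteq> Y" "block f X Y \<le> block h X' Y'"
    using block_select[OF XY A le dom, of f k h] by blast
  define a where "a = area X Y"
  have "block f X Y = (\<delta> * q + (1 - \<delta>) * c) * a
      - (\<delta> * q + (1 - \<delta>) * c / p + q * \<delta> / (8 * p)) * block (\<lambda>x. x) X Y"
    unfolding f_def a_def by (simp only: block_diff block_const block_cmult)
  moreover have "(\<delta> * q + (1 - \<delta>) * c / p + q * \<delta> / (8 * p)) * block (\<lambda>x. x) X Y
      \<le> (\<delta> * q + (1 - \<delta>) * c / p + q * \<delta> / (8 * p)) * (p * a)"
    using p \<delta> q c by (intro mult_left_mono) (auto simp: a_def)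
  moreover have "(\<delta> * q + (1 - \<delta>) * c / p + q * \<delta> / (8 * p)) * (p * a)
      = \<delta> * q * a * p + (1 - \<delta>) * c * a + q * \<delta> * a / 8"
    using p by (simp add: field_simps)
  moreover have "\<delta> * q * a * p \<le> \<delta> * q * a * (3 / 4)"
    using p \<delta> q by (intro mult_left_mono) (auto simp: a_def)
  ultimately have lower: "\<delta> / 8 * q * a \<le> block f X Y"
    by (simp add: algebra_simps)
  have "block h X' Y' = area X' Y' - (1 - \<delta>) / p * block (\<lambda>x. x) X' Y' - \<beta> * block (\<lambda>x. x\<^sup>2) X' Y'"
    unfolding h_def by (simp only: block_diff block_const block_cmult mult_1)
  then have main: "\<delta> / 8 * q * a + (1 - \<delta>) / p * block (\<lambda>x. x) X' Y' + \<beta> * block (\<lambda>x. x\<^sup>2) X' Y' \<le> area X' Y'"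
    using lower X'Y'(3) by linarith
  have X'Y'_sub: "X' \<subseteq> S" "Y' \<subseteq> T"
    using X'Y' XY by auto
  have "0 \<le> block (\<lambda>x. x) X' Y'" "0 \<le> block (\<lambda>x. x\<^sup>2) X' Y'"
    by (rule block_nonneg[OF X'Y'_sub]; fastforce)+
  then have nonneg: "0 \<le> (1 - \<delta>) / p * block (\<lambda>x. x) X' Y'" "0 \<le> \<beta> * block (\<lambda>x. x\<^sup>2) X' Y'"
    "0 \<le> \<delta> / 8 * q * a"
    using \<delta> p \<beta> q by (simp_all add: a_def)
  show ?thesis
  proof
    show "X' \<subseteq> X" "Y' \<subseteq> Y" by fact+
    show "\<delta> / 8 * (1 / 4) ^ k * area X Y \<le> area X' Y'"
      using main nonneg unfolding q_def a_def by linarith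
    have "(1 - \<delta>) / p * block (\<lambda>x. x) X' Y' \<le> area X' Y'"
      using main nonneg by linarith
    then show "block (\<lambda>x. x) X' Y' \<le> p / (1 - \<delta>) * area X' Y'"
      using \<delta> p by (simp add: field_simps)
    have "\<beta> * block (\<lambda>x. x\<^sup>2) X' Y' \<le> area X' Y'"
      using main nonneg by linarith
    then have "block (\<lambda>x. x\<^sup>2) X' Y' \<le> area X' Y' / \<beta>"
      using \<beta> by (simp add: field_simps)
    then show "block (\<lambda>x. x\<^sup>2) X' Y' \<le> 24 * A * p / (\<delta> * k) * area X' Y'"
      by (simp add: \<beta>_def mult.commute)
  qed
qed

text \<open>Only zero entries are credited: they carry at least a quarter of the area, weighted by
  \<open>q\<close>. Nonzero entries are at least 1, hence damped by a further \<open>E\<close>, and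
  \<open>\<beta>\<close> lets their penalty consume half of that quarter.\<close>

lemma select_final:
  assumes XY: "X \<subseteq> S" "Y \<subseteq> T" and A: "0 < A"
    and le: "\<And>i j. i \<in> X \<Longrightarrow> j \<in> Y \<Longrightarrow> M i j \<le> A"
    and dom: "rect_dominated X Y (\<lambda>i j. rounding_kernel (M i j / A))"
    and nz: "block (\<lambda>x. of_bool (x \<noteq> 0)) X Y \<le> 3 / 4 * area X Y"
    and F: "0 < F" "block (\<lambda>x. x\<^sup>2) X Y \<le> F * area X Y"
  obtains X' Y' where "X' \<subseteq> X" "Y' \<subseteq> Y" "1 / 8 * (1 / 4) ^ k * area X Y \<le> area X' Y'"
    and "block (\<lambda>x. x\<^sup>2) X' Y' \<le> 8 * F * exp (- (k / (3 * A))) * area X' Y'"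
proof -
  define q where "q = (1 / 4 :: real) ^ k"
  define E where "E = exp (- (k / (3 * A)))"
  define \<beta> where "\<beta> = 1 / (8 * F * E)"
  define h where "h x = 1 - \<beta> * x\<^sup>2" for x
  define f where "f x = q - q * of_bool (x \<noteq> 0) - \<beta> * q * E * x\<^sup>2" for x :: real
  have q: "q > 0" and E: "E > 0" and \<beta>: "\<beta> > 0"
    using F by (simp_all add: q_def E_def \<beta>_def)
  have "f x \<le> rounding_kernel (x / A) ^ k * h x" if x: "x = 0 \<or> x \<ge> 1" "x \<le> A" for x
  proof (cases "x = 0")
    case True
    then show ?thesis
      by (simp add: f_def h_def q_def)
  next
    case False
    define K where "K = rounding_kernel (x / A) ^ k"
    have x1: "1 \<le> x"
      using x False by auto
    have K: "0 \<le> K" "K \<le> q * exp (- (k * x / (3 * A)))"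
      using kernel_power_bounds[OF A _ x(2), of k] x1 by (simp_all add: K_def q_def)
    have "k / (3 * A) * 1 \<le> k / (3 * A) * x"
      using x1 A by (intro mult_left_mono) auto
    then have "q * exp (- (k * x / (3 * A))) \<le> q * E"
      unfolding E_def using q by (intro mult_left_mono) auto
    with K have "K * (\<beta> * x\<^sup>2) \<le> q * E * (\<beta> * x\<^sup>2)"
      using \<beta> by (intro mult_right_mono) auto
    then show ?thesis
      using False K unfolding K_def[symmetric] f_def h_def by (simp add: algebra_simps)
  qed
  then obtain X' Y' where X'Y': "X' \<subseteq> X" "Y' \<subseteq> Y" "block f X Y \<le> block h X' Y'"
    using block_select[OF XY A le dom, of f k h] by blast
  define a where "a = area X Y"
  have "block f X Y = q * a - q * block (\<lambda>x. of_bool (x \<noteq> 0)) X Y - \<beta> * q * E * block (\<lambda>x. x\<^sup>2) X Y"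
    unfolding f_def a_def by (simp only: block_diff block_const block_cmult)
  moreover have "q * block (\<lambda>x. of_bool (x \<noteq> 0)) X Y \<le> q * (3 / 4 * a)"
    using nz q by (intro mult_left_mono) (auto simp: a_def)
  moreover have "\<beta> * q * E * block (\<lambda>x. x\<^sup>2) X Y \<le> \<beta> * q * E * (F * a)"
    using F(2) q \<beta> E by (intro mult_left_mono) (auto simp: a_def)
  moreover have "\<beta> * q * E * (F * a) = 1 / 8 * q * a"
    using F E by (simp add: \<beta>_def)
  moreover have "q * (3 / 4 * a) = 6 / 8 * q * a"
    by simp
  moreover have "q * a = 8 / 8 * q * a"
    by simp
  ultimately have lower: "1 / 8 * q * a \<le> block f X Y"
    by linarith
  have "block h X' Y' = area X' Y' - \<beta> * block (\<lambda>x. x\<^sup>2) X' Y'"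
    unfolding h_def by (simp only: block_diff block_const block_cmult mult_1)
  then have main: "1 / 8 * q * a + \<beta> * block (\<lambda>x. x\<^sup>2) X' Y' \<le> area X' Y'"
    using lower X'Y'(3) by linarith
  have X'Y'_sub: "X' \<subseteq> S" "Y' \<subseteq> T"
    using X'Y' XY by auto
  have "0 \<le> block (\<lambda>x. x\<^sup>2) X' Y'"
    by (rule block_nonneg[OF X'Y'_sub]) simp
  then have nonneg: "0 \<le> \<beta> * block (\<lambda>x. x\<^sup>2) X' Y'" "0 \<le> 1 / 8 * q * a"
    using \<beta> q by (simp_all add: a_def)
  show ?thesis
  proof
    show "X' \<subseteq> X" "Y' \<subseteq> Y" by fact+
    show "1 / 8 * (1 / 4) ^ k * area X Y \<le> area X' Y'"
      using main nonneg unfolding q_def a_def by linarith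
    have "\<beta> * block (\<lambda>x. x\<^sup>2) X' Y' \<le> area X' Y'"
      using main nonneg by linarith
    then have "block (\<lambda>x. x\<^sup>2) X' Y' \<le> area X' Y' / \<beta>"
      using \<beta> by (simp add: field_simps)
    then show "block (\<lambda>x. x\<^sup>2) X' Y' \<le> 8 * F * exp (- (k / (3 * A))) * area X' Y'"
      by (simp add: \<beta>_def E_def mult.commute)
  qed
qed

end

section \<open>The three phases of the iteration\<close>

text \<open>The index counts the steps still to go. The double exponential undoes repeated square
  roots; \<open>64 ^ s\<close> solves the recursion when a step also loses a factor of order
  \<open>8 ^ s\<close>, which arises as \<open>1 / (\<delta>\<^sup>2 * y)\<close> with
  \<open>\<delta>\<close> and \<open>y\<close> of order \<open>1 / 2 ^ s\<close>.\<close>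

definition schedule :: "nat \<Rightarrow> real" where
  "schedule s = 64 ^ s * 2 ^ (2 ^ s)"

lemma schedule_pos [simp]: "0 < schedule s"
  by (simp add: schedule_def)

lemma schedule_nonneg [simp]: "0 \<le> schedule s"
  by (simp add: less_imp_le)

lemma sqrt_schedule_Suc: "sqrt (schedule (Suc s)) * 8 ^ s = 8 * schedule s"
proof -
  have "schedule (Suc s) = (8 * 8 ^ s * 2 ^ (2 ^ s))\<^sup>2"
  proof -
    have "((2::real) ^ (2 ^ s))\<^sup>2 = 2 ^ (2 ^ Suc s)"
      by (simp add: power_mult[symmetric] mult.commute)
    moreover have "((8::real) ^ s)\<^sup>2 = 64 ^ s"
      by (simp add: power2_eq_square flip: power_mult_distrib)
    ultimately show ?thesis
      by (simp add: schedule_def power_mult_distrib)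
  qed
  then have "sqrt (schedule (Suc s)) = 8 * 8 ^ s * 2 ^ (2 ^ s)"
    by (simp only: real_sqrt_abs) simp
  moreover have "(8::real) ^ s * 8 ^ s = 64 ^ s"
    by (simp flip: power_mult_distrib)
  ultimately show ?thesis
    by (simp add: schedule_def algebra_simps)
qed

lemma schedule_ge: "real s \<le> schedule s"
proof -
  have "real s \<le> 2 ^ s"
    using of_nat_less_two_power[of s, where 'a = real] by simp
  also have "\<dots> \<le> 64 ^ s * 1"
    by (simp add: power_mono)
  also have "\<dots> \<le> schedule s"
    unfolding schedule_def by (intro mult_left_mono) simp_all
  finally show ?thesis .
qed

context sparse_low_rank
begin

lemma trim_second_moment:
  fixes A :: real
  assumes "X \<subseteq> S" "Y \<subseteq> T" "\<And>i j. i \<in> X \<Longrightarrow> j \<in> Y \<Longrightarrow> M i j \<le> A"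
  shows "block (\<lambda>x. x\<^sup>2) X Y \<le> A * block (\<lambda>x. x) X Y"
proof -
  have "(M i j)\<^sup>2 \<le> A * M i j" if "i \<in> X" "j \<in> Y" for i j
    unfolding power2_eq_square using assms that by (intro mult_right_mono entry_nonneg) auto
  then show ?thesis
    unfolding block_def sum_distrib_left by (intro sum_mono)
qed

text \<open>After trimming, the mean is at most 1 and the entries at most \<open>A\<close>, so
  \<open>A\<close> is the new second moment. The factor \<open>2 ^ 20\<close> reproduces itself,
  being its own square root times \<open>128 * 8\<close>. The conclusion is free of
  \<open>s\<close>: the number of steps costs nothing, since the discarded proportions are
  summable.\<close>

lemma bound_second_moment:
  assumes mean: "block (\<lambda>x. x) S T \<le> 1 / 2 * area S T"
    and "X \<subseteq> S" "Y \<subseteq> T" "(1 - 1 / (17 * 2 ^ s)) * area S T \<le> area X Y"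
    and "block (\<lambda>x. x\<^sup>2) X Y \<le> 2 ^ 20 * r * schedule s * area X Y"
  shows "\<exists>X'\<subseteq>S. \<exists>Y'\<subseteq>T. 16 / 17 * area S T \<le> area X' Y' \<and>
    block (\<lambda>x. x\<^sup>2) X' Y' \<le> 2 ^ 21 * r * area X' Y'"
  using assms(2-)
proof (induction s arbitrary: X Y)
  case 0
  then show ?case
    by (intro exI[of _ X] exI[of _ Y] conjI) (simp_all add: schedule_def)
next
  case (Suc s)
  define y where "y = 1 / (2::real) ^ s"
  have y: "0 < y" "y \<le> 1"
    by (simp_all add: y_def)
  define \<delta> where "\<delta> = y / 128"
  define F where "F = 2 ^ 20 * r * schedule (Suc s)"
  define A where "A = sqrt (r * F) / \<delta>"
  have \<delta>: "0 < \<delta>" "\<delta> < 1" and F: "0 < F"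
    using y r_pos by (auto simp: \<delta>_def F_def)
  have A: "A \<le> 2 ^ 20 * r * schedule s"
  proof -
    have "r * F = (2 ^ 10 * r)\<^sup>2 * schedule (Suc s)"
      by (simp add: F_def power2_eq_square)
    then have "A = 2 ^ 10 * r * (sqrt (schedule (Suc s)) * (128 * 2 ^ s))"
      by (simp add: A_def \<delta>_def y_def real_sqrt_mult)
    \<comment> \<open>This phase loses only \<open>2 ^ s\<close>; allowing \<open>8 ^ s\<close> lets
      it share the schedule with the next one.\<close>
    also have "\<dots> \<le> 2 ^ 10 * r * (sqrt (schedule (Suc s)) * (128 * 8 ^ s))"
      using less_imp_le[OF schedule_pos[of "Suc s"]] by (intro mult_left_mono) (auto intro: power_mono)
    also have "\<dots> = 2 ^ 10 * r * (128 * (8 * schedule s))"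
      using sqrt_schedule_Suc[of s] by simp
    finally show ?thesis by simp
  qed
  obtain X' Y' where sub: "X' \<subseteq> X" "Y' \<subseteq> Y" and ar: "(1 - \<delta>)\<^sup>2 * area X Y \<le> area X' Y'"
    and le: "\<And>i j. i \<in> X' \<Longrightarrow> j \<in> Y' \<Longrightarrow> M i j \<le> A"
    by (rule trim[OF Suc.prems(1,2) F \<delta> Suc.prems(4)[folded F_def], folded A_def]) (blast intro: that)
  have sub': "X' \<subseteq> S" "Y' \<subseteq> T"
    using sub Suc.prems by auto
  have "1 - y / 17 \<le> (1 - 2 * \<delta>) * (1 - y / 34)"
    using y by (simp add: \<delta>_def algebra_simps)
  also have "\<dots> \<le> (1 - \<delta>)\<^sup>2 * (1 - y / 34)"
    using y by (intro mult_right_mono) (auto simp: power2_diff)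
  finally have "(1 - y / 17) * area S T \<le> (1 - \<delta>)\<^sup>2 * (1 - y / 34) * area S T"
    by (intro mult_right_mono) auto
  also have "\<dots> \<le> (1 - \<delta>)\<^sup>2 * area X Y"
    using Suc.prems(3) by (simp add: y_def mult.assoc mult.commute[of "2 ^ s"] mult_left_mono)
  finally have area: "(1 - y / 17) * area S T \<le> area X' Y'"
    using ar by simp
  have "16 / 17 * area S T \<le> (1 - y / 17) * area S T"
    using y by (intro mult_right_mono) auto
  with area have area2: "16 / 17 * area S T \<le> area X' Y'"
    by linarith
  have "block (\<lambda>x. x) X' Y' \<le> block (\<lambda>x. x) S T"
    by (rule block_subset_mono) (use sub' in auto)
  with mean area2 have id: "block (\<lambda>x. x) X' Y' \<le> area X' Y'"
    using area_nonneg[of S T] by linarith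
  have "block (\<lambda>x. x\<^sup>2) X' Y' \<le> A * block (\<lambda>x. x) X' Y'"
    by (rule trim_second_moment[OF sub' le])
  also have "\<dots> \<le> A * area X' Y'"
    using id F \<delta> by (intro mult_left_mono) (auto simp: A_def)
  also have "\<dots> \<le> 2 ^ 20 * r * schedule s * area X' Y'"
    using A by (intro mult_right_mono) auto
  finally show ?case
    using Suc.IH[OF sub'] area by (simp add: y_def mult.commute[of "2 ^ s"])
qed

text \<open>With \<open>y = 1 / 2 ^ s\<close>, a step takes about \<open>R * y\<close> copies and
  \<open>\<delta> = y / 512\<close>: the copies cost at most \<open>4 * R\<close> bits in total, and
  the density grows by at most 17/16 overall. The term with 15 collects trimming, the factor
  \<open>\<delta> / 8\<close> and the rounding of \<open>k\<close>.\<close>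

lemma bound_second_moment_by_density:
  fixes P :: real
  assumes P: "0 < P" "P \<le> 17 / 32"
    and "X \<subseteq> S" "Y \<subseteq> T" "block (\<lambda>x. x) X Y \<le> P * (1 + 1 / (16 * 2 ^ s)) * area X Y"
    and "block (\<lambda>x. x\<^sup>2) X Y \<le> 2 ^ 54 * schedule s * P * area X Y"
  shows "\<exists>X'\<subseteq>S. \<exists>Y'\<subseteq>T.
    2 powr - (4 * sqrt (r * P) * (1 - 1 / 2 ^ s) + 15 * (2 ^ s - 1)) * area X Y \<le> area X' Y' \<and>
    block (\<lambda>x. x) X' Y' \<le> 17 / 16 * P * area X' Y' \<and>
    block (\<lambda>x. x\<^sup>2) X' Y' \<le> 2 ^ 55 * P * area X' Y'"
  using assms(3-)
proof (induction s arbitrary: X Y)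
  case 0
  then show ?case
    by (intro exI[of _ X] exI[of _ Y] conjI) (simp_all add: schedule_def mult.commute)
next
  case (Suc s)
  define y where "y = 1 / (2::real) ^ s"
  have y: "0 < y" "y \<le> 1"
    by (simp_all add: y_def)
  define \<delta> where "\<delta> = y / 512"
  define F where "F = 2 ^ 54 * schedule (Suc s) * P"
  define A where "A = sqrt (r * F) / \<delta>"
  define R where "R = sqrt (r * P)"
  \<comment> \<open>Rounding up guarantees at least one copy, as \<open>select_middle\<close>
    demands, and costs at most two bits.\<close>
  define k where "k = nat \<lceil>R * y\<rceil>"
  have \<delta>: "0 < \<delta>" "\<delta> < 1" "\<delta> \<le> 1 / 512" and F: "0 < F" and R: "0 < R"
    using y r_pos P by (auto simp: \<delta>_def F_def R_def)
  have A_pos: "0 < A"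
    using F r_pos \<delta> by (simp add: A_def)
  have "0 < R * y"
    using R y by simp
  then have k: "k \<ge> 1" "R * y \<le> k" "real k \<le> R * y + 1"
    unfolding k_def by linarith+
  obtain X1 Y1 where sub: "X1 \<subseteq> X" "Y1 \<subseteq> Y" and ar: "(1 - \<delta>)\<^sup>2 * area X Y \<le> area X1 Y1"
    and le: "\<And>i j. i \<in> X1 \<Longrightarrow> j \<in> Y1 \<Longrightarrow> M i j \<le> A"
    and dom: "rect_dominated X1 Y1 (\<lambda>i j. rounding_kernel (M i j / A))"
    by (rule trim[OF Suc.prems(1,2) F \<delta>(1,2) Suc.prems(4)[folded F_def], folded A_def]) (blast intro: that)
  have sub': "X1 \<subseteq> S" "Y1 \<subseteq> T"
    using sub Suc.prems by auto
  define p where "p = P * (1 + y / 32)"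
  define p1 where "p1 = p / (1 - \<delta>)\<^sup>2"
  have \<delta>2: "(1 - \<delta>)\<^sup>2 \<ge> 255 / 256"
    using \<delta> power_mono[of "511 / 512" "1 - \<delta>" 2] by (simp add: power2_eq_square)
  have p: "0 < p" "p \<le> P * (33 / 32)"
    using P y unfolding p_def by (auto intro: mult_left_mono)
  have "p1 \<le> p / (255 / 256)"
    unfolding p1_def using p \<delta>2 by (intro divide_left_mono) auto
  then have p1: "0 < p1" "p1 \<le> 3 / 4" "p1 \<le> 2 * P"
    using p P \<delta> by (auto simp: p1_def)
  have "block (\<lambda>x. x) X1 Y1 \<le> block (\<lambda>x. x) X Y"
    by (rule block_subset_mono) (use Suc.prems sub in auto)
  also have "\<dots> \<le> p * area X Y"
    using Suc.prems(3) by (simp add: p_def y_def mult.commute)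
  also have "\<dots> = p1 * ((1 - \<delta>)\<^sup>2 * area X Y)"
    using \<delta> by (simp add: p1_def)
  also have "\<dots> \<le> p1 * area X1 Y1"
    using ar p1 by (intro mult_left_mono) auto
  finally have mean: "block (\<lambda>x. x) X1 Y1 \<le> p1 * area X1 Y1" .
  obtain X' Y' where X'Y': "X' \<subseteq> X1" "Y' \<subseteq> Y1" "\<delta> / 8 * (1 / 4) ^ k * area X1 Y1 \<le> area X' Y'"
    and mean': "block (\<lambda>x. x) X' Y' \<le> p1 / (1 - \<delta>) * area X' Y'"
    and sq': "block (\<lambda>x. x\<^sup>2) X' Y' \<le> 24 * A * p1 / (\<delta> * k) * area X' Y'"
    using select_middle[OF sub' A_pos le dom p1(1,2) mean \<delta>(1,2) k(1)] by blast
  have sub'': "X' \<subseteq> S" "Y' \<subseteq> T"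
    using X'Y' sub' by auto
  \<comment> \<open>Two factors \<open>1 - \<delta>\<close> are lost by trimming, the third by the
    selection.\<close>
  have "p1 / (1 - \<delta>) \<le> P * (1 + y / 16)"
  proof -
    have "y * y \<le> 1 * y"
      using y by (intro mult_right_mono) auto
    moreover have "(1 + y / 16) * (1 - 3 * \<delta>) = 1 + y / 16 - 3 / 512 * y - 3 / 8192 * (y * y)"
      by (simp add: \<delta>_def field_simps)
    ultimately have "1 + y / 32 \<le> (1 + y / 16) * (1 - 3 * \<delta>)"
      using y by linarith
    also have "\<dots> \<le> (1 + y / 16) * (1 - \<delta>) ^ 3"
    proof (intro mult_left_mono)
      show "1 - 3 * \<delta> \<le> (1 - \<delta>) ^ 3"
        using Bernoulli_inequality[of "- \<delta>" 3] \<delta> by simp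
    qed (use y in auto)
    finally have "(1 + y / 32) / (1 - \<delta>) ^ 3 \<le> 1 + y / 16"
      using \<delta> by (simp add: pos_divide_le_eq)
    then have "P * ((1 + y / 32) / (1 - \<delta>) ^ 3) \<le> P * (1 + y / 16)"
      using P by (intro mult_left_mono) auto
    moreover have "p1 / (1 - \<delta>) = P * ((1 + y / 32) / (1 - \<delta>) ^ 3)"
      by (simp add: p1_def p_def power3_eq_cube power2_eq_square)
    ultimately show ?thesis by simp
  qed
  then have "p1 / (1 - \<delta>) * area X' Y' \<le> P * (1 + y / 16) * area X' Y'"
    by (intro mult_right_mono) auto
  with mean' have IH1: "block (\<lambda>x. x) X' Y' \<le> P * (1 + 1 / (16 * 2 ^ s)) * area X' Y'"
    by (simp add: y_def mult.commute[of "2 ^ s"])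
  have "24 * A * p1 / (\<delta> * k) \<le> 2 ^ 54 * schedule s * P"
  proof -
    have "r * F = (2 ^ 27)\<^sup>2 * (r * P) * schedule (Suc s)"
      by (simp add: F_def power2_eq_square)
    then have "sqrt (r * F) = sqrt ((2 ^ 27)\<^sup>2) * R * sqrt (schedule (Suc s))"
      unfolding R_def by (simp only: real_sqrt_mult)
    also have "sqrt ((2 ^ 27)\<^sup>2) = 2 ^ 27"
      by (simp only: real_sqrt_abs) simp
    finally have "sqrt (r * F) = 2 ^ 27 * R * sqrt (schedule (Suc s))" .
    then have A: "A = 2 ^ 27 * R * sqrt (schedule (Suc s)) / \<delta>"
      by (simp add: A_def)
    have "24 * A * p1 / (\<delta> * k) \<le> 24 * A * (2 * P) / (\<delta> * (R * y))"
      using p1 k \<delta> R y A_pos by (intro frac_le mult_left_mono) auto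
    also have "\<dots> = 48 * 2 ^ 27 * P * sqrt (schedule (Suc s)) / (\<delta>\<^sup>2 * y)"
      using R \<delta> y unfolding A by (simp add: power2_eq_square mult_ac)
    also have "\<dots> = 48 * 2 ^ 27 * P * 512\<^sup>2 * (sqrt (schedule (Suc s)) * (1 / y) ^ 3)"
      using y by (simp add: \<delta>_def power2_eq_square power3_eq_cube)
    also have "(1 / y) ^ 3 = 8 ^ s"
      using power_mult[of "2::real" s 3] power_mult[of "2::real" 3 s] by (simp add: y_def mult.commute)
    also have "sqrt (schedule (Suc s)) * 8 ^ s = 8 * schedule s"
      by (rule sqrt_schedule_Suc)
    \<comment> \<open>The constant \<open>2 ^ 54\<close> survives the step because 48 is below
      \<open>2 ^ 6\<close>.\<close>
    also have "48 * 2 ^ 27 * P * 512\<^sup>2 * (8 * schedule s) = (48 * 2 ^ 48) * (schedule s * P)"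
      by simp
    also have "\<dots> \<le> 2 ^ 54 * (schedule s * P)"
      using P by (intro mult_right_mono) auto
    finally show ?thesis
      by (simp add: mult.assoc)
  qed
  then have "24 * A * p1 / (\<delta> * k) * area X' Y' \<le> 2 ^ 54 * schedule s * P * area X' Y'"
    by (intro mult_right_mono) auto
  with sq' have IH2: "block (\<lambda>x. x\<^sup>2) X' Y' \<le> 2 ^ 54 * schedule s * P * area X' Y'"
    by linarith
  obtain X'' Y'' where X''Y'': "X'' \<subseteq> S" "Y'' \<subseteq> T"
    "2 powr - (4 * R * (1 - y) + 15 * (2 ^ s - 1)) * area X' Y' \<le> area X'' Y''"
    "block (\<lambda>x. x) X'' Y'' \<le> 17 / 16 * P * area X'' Y''"
    "block (\<lambda>x. x\<^sup>2) X'' Y'' \<le> 2 ^ 55 * P * area X'' Y''"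
    using Suc.IH[OF sub'' IH1 IH2] unfolding R_def y_def by blast
  have "2 powr - (2 * R * y + 15 * 2 ^ s) * area X Y \<le> area X' Y'"
  proof -
    \<comment> \<open>Beyond the copies a step costs about \<open>s + 15\<close> bits. The crude
      bound \<open>15 * 2 ^ s\<close> keeps the total of order \<open>2 ^ s\<close>, which the
      application makes of order \<open>log 2 r\<close>.\<close>
    have "real (s + 1) \<le> real (2 ^ s)"
      using Suc_leI[OF less_exp[of s]] by (simp only: of_nat_le_iff Suc_eq_plus1)
    then have "real s + 15 \<le> 15 * 2 ^ s"
      by simp
    then have "2 powr - (2 * R * y + 15 * 2 ^ s) \<le> 2 powr (- real (2 * k) - real (s + 13))"
      using k by (intro powr_mono) auto
    also have "\<dots> = inverse (2 powr real (2 * k)) / 2 powr real (s + 13)"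
      by (simp only: powr_diff powr_minus)
    also have "\<dots> = inverse (2 ^ (2 * k)) / 2 ^ (s + 13)"
      by (simp only: powr_realpow zero_less_numeral)
    also have "\<dots> = (1 / 4) ^ k * (y / 2 ^ 13)"
      by (simp add: power_mult power_add y_def power_one_over inverse_eq_divide)
    also have "\<dots> = \<delta> / 8 * (1 / 4) ^ k * (1 / 2)"
      by (simp add: \<delta>_def)
    also have "\<dots> \<le> \<delta> / 8 * (1 / 4) ^ k * (1 - \<delta>)\<^sup>2"
      using \<delta> \<delta>2 by (intro mult_left_mono) auto
    finally have "2 powr - (2 * R * y + 15 * 2 ^ s) * area X Y \<le>
        \<delta> / 8 * (1 / 4) ^ k * (1 - \<delta>)\<^sup>2 * area X Y"
      by (intro mult_right_mono) auto
    also have "\<dots> \<le> \<delta> / 8 * (1 / 4) ^ k * area X1 Y1"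
      unfolding mult.assoc[of "\<delta> / 8 * (1 / 4) ^ k"] using ar \<delta> by (intro mult_left_mono) auto
    finally show ?thesis
      using X'Y'(3) by simp
  qed
  then have "2 powr - (4 * R * (1 - y) + 15 * (2 ^ s - 1)) * (2 powr - (2 * R * y + 15 * 2 ^ s) * area X Y)
      \<le> 2 powr - (4 * R * (1 - y) + 15 * (2 ^ s - 1)) * area X' Y'"
    by (intro mult_left_mono) auto
  moreover have "2 powr - (4 * R * (1 - 1 / 2 ^ Suc s) + 15 * (2 ^ Suc s - 1)) =
      2 powr - (4 * R * (1 - y) + 15 * (2 ^ s - 1)) * 2 powr - (2 * R * y + 15 * 2 ^ s)"
    unfolding powr_add[symmetric] by (simp add: y_def algebra_simps)
  ultimately have "2 powr - (4 * R * (1 - 1 / 2 ^ Suc s) + 15 * (2 ^ Suc s - 1)) * area X Y \<le> area X'' Y''"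
    using X''Y''(3) by (simp only: mult.assoc)
  with X''Y'' show ?case
    unfolding R_def by blast
qed

text \<open>\<open>A\<close>, and with it \<open>k\<close>, is proportional to
  \<open>2 ^ (28 * s)\<close>, so the costs form a geometric sum dominated by the first step. At
  \<open>s = 0\<close> the second moment itself bounds the density of nonzeros. A step actually
  divides the second moment by \<open>2 ^ 112\<close>, although the induction needs only
  \<open>2 ^ 56\<close>; the surplus and the cap in the third hypothesis restore the 5/8 bound on
  nonzeros.\<close>

lemma bound_nonzeros:
  assumes "X \<subseteq> S" "Y \<subseteq> T" "2 ^ (56 * s) / (4 * r) \<le> (5 / 8 * 2 ^ 112 :: real)"
    and "block (\<lambda>x. x\<^sup>2) X Y \<le> 2 ^ (56 * s) / (4 * r) * area X Y"
    and "block (\<lambda>x. of_bool (x \<noteq> 0)) X Y \<le> 5 / 8 * area X Y"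
  shows "\<exists>X'\<subseteq>S. \<exists>Y'\<subseteq>T. 2 powr - (13000 * 2 ^ (28 * s)) * area X Y \<le> area X' Y' \<and>
    block (\<lambda>x. of_bool (x \<noteq> 0)) X' Y' \<le> 1 / (4 * r) * area X' Y'"
  using assms
proof (induction s arbitrary: X Y)
  case 0
  have "block (\<lambda>x. of_bool (x \<noteq> 0)) X Y \<le> block (\<lambda>x. x\<^sup>2) X Y"
    by (rule block_mono[OF 0(1,2)]) (auto simp: one_le_power)
  moreover have "2 powr - 13000 * area X Y \<le> 1 * area X Y"
    using powr_mono[of "- 13000" 0 "2 :: real"] by (intro mult_right_mono) auto
  ultimately show ?case
    using 0 by (intro exI[of _ X] exI[of _ Y] conjI) simp_all
next
  case (Suc s)
  define B where "B = (2::real) ^ (28 * s)"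
  have B: "1 \<le> B" "2 ^ (28 * Suc s) = 2 ^ 28 * B" "2 ^ (56 * s) = B\<^sup>2"
    by (simp_all add: B_def power_add power_mult[symmetric])
  have B2: "2 ^ (56 * Suc s) = 2 ^ 56 * B\<^sup>2"
    unfolding B(3)[symmetric] by (simp add: power_add)
  define F where "F = 2 ^ 56 * B\<^sup>2 / (4 * r)"
  define \<delta> where "\<delta> = 1 / (32::real)"
  define A where "A = sqrt (r * F) / \<delta>"
  have "0 < F"
    using B r_pos by (simp add: F_def)
  moreover have "F \<le> 5 / 8 * 2 ^ 112"
    using Suc.prems(3) unfolding F_def B2 .
  ultimately have F: "0 < F" "F \<le> 5 / 8 * 2 ^ 112" and \<delta>: "0 < \<delta>" "\<delta> < 1"
    by (simp_all add: \<delta>_def)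
  have A: "A = 2 ^ 32 * B"
  proof -
    have "r * F = (2 ^ 27 * B)\<^sup>2"
      using r_pos by (simp add: F_def power2_eq_square)
    then have "sqrt (r * F) = 2 ^ 27 * B"
      using B(1) by (simp only: real_sqrt_abs) simp
    then show ?thesis
      by (simp add: A_def \<delta>_def)
  qed
  have A_pos: "0 < A"
    using B by (simp add: A)
  obtain X1 Y1 where sub: "X1 \<subseteq> X" "Y1 \<subseteq> Y" and ar: "(1 - \<delta>)\<^sup>2 * area X Y \<le> area X1 Y1"
    and le: "\<And>i j. i \<in> X1 \<Longrightarrow> j \<in> Y1 \<Longrightarrow> M i j \<le> A"
    and dom: "rect_dominated X1 Y1 (\<lambda>i j. rounding_kernel (M i j / A))"
    by (rule trim[OF Suc.prems(1,2) F(1) \<delta> Suc.prems(4)[unfolded B2, folded F_def], folded A_def]) (blast intro: that)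
  have sub': "X1 \<subseteq> S" "Y1 \<subseteq> T"
    using sub Suc.prems by auto
  have \<delta>2: "(1 - \<delta>)\<^sup>2 = 961 / 1024"
    by (simp add: \<delta>_def power2_eq_square)
  \<comment> \<open>5/8 divided by 5/6 is 3/4, the density that \<open>select_final\<close>
    admits.\<close>
  from ar have ar': "5 / 6 * area X Y \<le> area X1 Y1"
    unfolding \<delta>2
    using area_nonneg[of X Y] by linarith
  have "block (\<lambda>x. of_bool (x \<noteq> 0)) X1 Y1 \<le> block (\<lambda>x. of_bool (x \<noteq> 0)) X Y"
    by (rule block_subset_mono) (use Suc.prems sub in auto)
  with Suc.prems(5) ar' have nz: "block (\<lambda>x. of_bool (x \<noteq> 0)) X1 Y1 \<le> 3 / 4 * area X1 Y1"
    by linarith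
  have "block (\<lambda>x. x\<^sup>2) X1 Y1 \<le> block (\<lambda>x. x\<^sup>2) X Y"
    by (rule block_subset_mono) (use Suc.prems sub in auto)
  also have "\<dots> \<le> F * area X Y"
    using Suc.prems(4) unfolding F_def B2 .
  also have "\<dots> \<le> F * (2 * area X1 Y1)"
    using F ar' area_nonneg[of X Y] by (intro mult_left_mono) linarith+
  finally have sq: "block (\<lambda>x. x\<^sup>2) X1 Y1 \<le> (2 * F) * area X1 Y1"
    by simp
  \<comment> \<open>Makes \<open>k / (3 * A)\<close> equal to 125, more than the 116 needed: 112 for
    the decrease and 4 for the factors 8 and 2 in front of \<open>F\<close>.\<close>
  define k :: nat where "k = 6000 * 2 ^ (28 * Suc s)"
  have k: "real k = 6000 * 2 ^ 28 * B"
    unfolding k_def of_nat_mult of_nat_power of_nat_numeral B(2) by simp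
  obtain X' Y' where X'Y': "X' \<subseteq> X1" "Y' \<subseteq> Y1" "1 / 8 * (1 / 4) ^ k * area X1 Y1 \<le> area X' Y'"
    and sq': "block (\<lambda>x. x\<^sup>2) X' Y' \<le> 8 * (2 * F) * exp (- (k / (3 * A))) * area X' Y'"
    using select_final[OF sub' A_pos le dom nz _ sq, of k] F by auto
  have sub'': "X' \<subseteq> S" "Y' \<subseteq> T"
    using X'Y' sub' by auto
  have exp_le: "exp (- (k / (3 * A))) \<le> 1 / 2 ^ 116"
  proof -
    have "(2::real) ^ 116 \<le> exp 1 ^ 116"
      using exp_ge_add_one_self[of 1] by (intro power_mono) auto
    also have "\<dots> = exp 116"
      by (simp add: exp_of_nat_mult[symmetric])
    also have "\<dots> \<le> exp (k / (3 * A))"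
      using B unfolding k A by simp
    finally show ?thesis
      by (simp add: exp_minus field_simps)
  qed
  have "8 * (2 * F) * exp (- (k / (3 * A))) \<le> 8 * (2 * F) * (1 / 2 ^ 116)"
    using F exp_le by (intro mult_left_mono) auto
  also have "\<dots> = F / 2 ^ 112"
    by simp
  finally have "8 * (2 * F) * exp (- (k / (3 * A))) * area X' Y' \<le> F / 2 ^ 112 * area X' Y'"
    by (intro mult_right_mono) auto
  with sq' have sq'': "block (\<lambda>x. x\<^sup>2) X' Y' \<le> F / 2 ^ 112 * area X' Y'"
    by linarith
  have "block (\<lambda>x. of_bool (x \<noteq> 0)) X' Y' \<le> block (\<lambda>x. x\<^sup>2) X' Y'"
    by (rule block_mono[OF sub'']) (auto simp: one_le_power)
  also note sq''
  also have "F / 2 ^ 112 * area X' Y' \<le> 5 / 8 * area X' Y'"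
    using F by (intro mult_right_mono) auto
  finally have IH3: "block (\<lambda>x. of_bool (x \<noteq> 0)) X' Y' \<le> 5 / 8 * area X' Y'" .
  have FB: "F = 2 ^ 56 * (2 ^ (56 * s) / (4 * r))"
    unfolding F_def B(3) by simp
  then have IH1: "2 ^ (56 * s) / (4 * r) \<le> (5 / 8 * 2 ^ 112 :: real)"
    using F by simp
  have shrink: "2 ^ 56 * t / 2 ^ 112 \<le> t" if "0 \<le> t" for t :: real
    using that by simp
  have "F / 2 ^ 112 \<le> 2 ^ (56 * s) / (4 * r)"
    unfolding FB by (rule shrink) simp
  then have "F / 2 ^ 112 * area X' Y' \<le> 2 ^ (56 * s) / (4 * r) * area X' Y'"
    by (intro mult_right_mono) auto
  with sq'' have IH2: "block (\<lambda>x. x\<^sup>2) X' Y' \<le> 2 ^ (56 * s) / (4 * r) * area X' Y'"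
    by linarith
  obtain X'' Y'' where X''Y'': "X'' \<subseteq> S" "Y'' \<subseteq> T"
    "2 powr - (13000 * B) * area X' Y' \<le> area X'' Y''"
    "block (\<lambda>x. of_bool (x \<noteq> 0)) X'' Y'' \<le> 1 / (4 * r) * area X'' Y''"
    using Suc.IH[OF sub'' IH1 IH2 IH3] unfolding B_def by blast
  have "2 powr - (2 * k + 4) * area X Y \<le> area X' Y'"
  proof -
    have "2 powr - (2 * k + 4) = 1 / 8 * (1 / 4) ^ k * (1 / 2)"
    proof -
      have "(2::real) powr - real (2 * k + 4) = 1 / 2 ^ (2 * k + 4)"
        by (simp only: powr_minus powr_realpow inverse_eq_divide zero_less_numeral)
      then show ?thesis
        by (simp add: power_add power_mult power_one_over)
    qed
    then have "2 powr - (2 * k + 4) * area X Y = 1 / 8 * (1 / 4) ^ k * (1 / 2 * area X Y)"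
      by simp
    also have "\<dots> \<le> 1 / 8 * (1 / 4) ^ k * area X1 Y1"
      using ar' area_nonneg[of X Y] by (intro mult_left_mono) (linarith, simp)
    finally show ?thesis
      using X'Y'(3) by simp
  qed
  then have "2 powr - (13000 * B) * (2 powr - (2 * k + 4) * area X Y) \<le> 2 powr - (13000 * B) * area X' Y'"
    by (intro mult_left_mono) auto
  \<comment> \<open>Of \<open>13000 * 2 ^ 28 * B\<close> bits, \<open>2 * k\<close> uses
    \<open>12000 * 2 ^ 28 * B\<close>; the rest pays for all later steps.\<close>
  moreover have "2 powr - (13000 * 2 ^ (28 * Suc s)) \<le> 2 powr - (13000 * B) * 2 powr - (2 * k + 4)"
    unfolding powr_add[symmetric] B(2) using B(1) k by (intro powr_mono) auto
  then have "2 powr - (13000 * 2 ^ (28 * Suc s)) * area X Y \<le>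
      2 powr - (13000 * B) * 2 powr - (2 * k + 4) * area X Y"
    by (intro mult_right_mono) auto
  ultimately have "2 powr - (13000 * 2 ^ (28 * Suc s)) * area X Y \<le> area X'' Y''"
    using X''Y''(3) by (simp only: mult.assoc)
  with X''Y'' show ?case
    by blast
qed

end

section \<open>Combining the phases\<close>

lemma dyadic_between:
  fixes b x :: real
  assumes "1 < b" "1 \<le> x"
  obtains s where "x \<le> b ^ s" "b ^ s \<le> b * x"
proof -
  obtain n where "x < b ^ n"
    using real_arch_pow[OF assms(1)] by blast
  then have ex: "\<exists>n. x \<le> b ^ n"
    using less_imp_le by blast
  define s where "s = (LEAST n. x \<le> b ^ n)"
  have s: "x \<le> b ^ s"
    unfolding s_def using ex by (rule LeastI_ex)
  have "b ^ s \<le> b * x"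
  proof (cases s)
    case 0
    then show ?thesis
      using mult_mono[of 1 b 1 x] assms by simp
  next
    case (Suc t)
    then have "\<not> x \<le> b ^ t"
      using not_less_Least[of t "\<lambda>n. x \<le> b ^ n"] unfolding s_def by simp
    then show ?thesis
      using assms Suc by simp
  qed
  with s show ?thesis
    by (rule that)
qed

context sparse_low_rank
begin

lemma zero_from_sparse:
  assumes "X \<subseteq> S" "Y \<subseteq> T" "block (\<lambda>x. of_bool (x \<noteq> 0)) X Y \<le> 1 / (4 * r) * area X Y"
  obtains X' Y' where "X' \<subseteq> S" "Y' \<subseteq> T" "1 / 4 * area X Y \<le> area X' Y'"
    "\<And>i j. i \<in> X' \<Longrightarrow> j \<in> Y' \<Longrightarrow> M i j = 0"
proof -
  have finXY: "finite X" "finite Y"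
    using assms fin finite_subset by blast+
  have "block (\<lambda>x. of_bool (x \<noteq> 0)) X Y = (\<Sum>i\<in>X. real (card {j\<in>Y. M i j \<noteq> 0}))"
    unfolding block_def using finXY by (intro sum.cong refl) (simp add: of_bool_def sum.If_cases Int_def)
  with assms(3) have sparse: "(\<Sum>i\<in>X. real (card {j\<in>Y. M i j \<noteq> 0})) \<le> 1 / (4 * real r) * real (card X * card Y)"
    by (simp add: area_def)
  obtain X' Y' where X'Y': "X' \<subseteq> X" "Y' \<subseteq> Y" "real (card X) / 2 \<le> card X'" "real (card Y) / 2 \<le> card Y'"
    "\<And>i j. i \<in> X' \<Longrightarrow> j \<in> Y' \<Longrightarrow> M i j = 0"
    by (rule sparse_zero_submatrix[OF finXY rank_le_subset[OF rank assms(1,2)] r_pos sparse])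
      (blast intro: that)
  have "1 / 4 * area X Y = (real (card X) / 2) * (real (card Y) / 2)"
    by (simp add: area_def)
  also have "\<dots> \<le> area X' Y'"
    unfolding area_def using X'Y' by (intro mult_mono) auto
  finally show ?thesis
    using that[of X' Y'] X'Y' assms(1,2) by blast
qed

text \<open>Separate because \<open>log 2 1 = 0\<close> leaves no constant factor to spare. The
  support is itself a rectangle with entries at least 1, so it fills at most a proportion
  \<open>\<epsilon>\<close> and one of its sides at most \<open>sqrt \<epsilon>\<close>; deleting
  that side leaves zeros.\<close>

lemma rank_one_zero_submatrix:
  assumes "r = 1" and mean: "block (\<lambda>x. x) S T \<le> \<epsilon> * area S T" and \<epsilon>: "0 \<le> \<epsilon>"
  obtains X Y where "X \<subseteq> S" "Y \<subseteq> T" "(1 - sqrt \<epsilon>) * area S T \<le> area X Y"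
    "\<And>i j. i \<in> X \<Longrightarrow> j \<in> Y \<Longrightarrow> M i j = 0"
proof -
  obtain a b where ab: "\<And>i j. i \<in> S \<Longrightarrow> j \<in> T \<Longrightarrow> M i j = a i * b j"
    using rank unfolding rank_le_def \<open>r = 1\<close> by force
  define U where "U = {i\<in>S. a i \<noteq> 0}"
  define V where "V = {j\<in>T. b j \<noteq> 0}"
  have sub: "U \<subseteq> S" "V \<subseteq> T"
    by (auto simp: U_def V_def)
  have "area U V = (\<Sum>i\<in>U. \<Sum>j\<in>V. 1)"
    by (simp add: area_def)
  also have "\<dots> \<le> block (\<lambda>x. x) U V"
    unfolding block_def
  proof (intro sum_mono)
    fix i j assume "i \<in> U" "j \<in> V"
    then have "i \<in> S" "j \<in> T" "M i j \<noteq> 0"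
      by (auto simp: U_def V_def ab)
    then show "1 \<le> M i j"
      using entries by blast
  qed
  also have "\<dots> \<le> block (\<lambda>x. x) S T"
    by (rule block_subset_mono) (use sub in auto)
  also have "\<dots> \<le> (sqrt \<epsilon> * sqrt \<epsilon>) * (card S * card T)"
    using mean \<epsilon> by (simp add: area_def)
  also have "\<dots> = (sqrt \<epsilon> * card S) * (sqrt \<epsilon> * card T)"
    by simp
  finally have UV: "area U V \<le> (sqrt \<epsilon> * card S) * (sqrt \<epsilon> * card T)" .
  have "card U \<le> sqrt \<epsilon> * card S \<or> card V \<le> sqrt \<epsilon> * card T"
  proof (rule ccontr)
    assume "\<not> ?thesis"
    then have "(sqrt \<epsilon> * card S) * (sqrt \<epsilon> * card T) < area U V"
      unfolding area_def using \<epsilon> by (intro mult_strict_mono') auto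
    with UV show False by simp
  qed
  then show ?thesis
  proof
    assume U: "card U \<le> sqrt \<epsilon> * card S"
    have "real (card (S - U)) = card S - card U"
      using sub fin by (simp add: card_Diff_subset finite_subset card_mono of_nat_diff)
    with U have "(1 - sqrt \<epsilon>) * card S \<le> card (S - U)"
      by (simp add: left_diff_distrib)
    then have "(1 - sqrt \<epsilon>) * area S T \<le> area (S - U) T"
      unfolding area_def mult.assoc[symmetric] by (intro mult_right_mono) auto
    then show ?thesis
      by (intro that[of "S - U" T]) (auto simp: U_def ab)
  next
    assume V: "card V \<le> sqrt \<epsilon> * card T"
    have "real (card (T - V)) = card T - card V"
      using sub fin by (simp add: card_Diff_subset finite_subset card_mono of_nat_diff)
    with V have "(1 - sqrt \<epsilon>) * card T \<le> card (T - V)"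
      by (simp add: left_diff_distrib)
    then have "card S * ((1 - sqrt \<epsilon>) * card T) \<le> area S (T - V)"
      unfolding area_def by (intro mult_left_mono) auto
    then have "(1 - sqrt \<epsilon>) * area S T \<le> area S (T - V)"
      by (simp add: area_def mult_ac)
    then show ?thesis
      by (intro that[of S "T - V"]) (auto simp: V_def ab)
  qed
qed

text \<open>The lower bound on \<open>\<epsilon>\<close> limits the ratio of the second moment to
  the density by a power of \<open>r\<close>, so log log r steps suffice; constant losses are
  absorbed by \<open>log 2 r \<ge> 1\<close>.\<close>

lemma zero_submatrix_dense:
  fixes \<epsilon> :: real
  assumes r: "r \<ge> 2" and mean: "block (\<lambda>x. x) S T \<le> \<epsilon> * area S T"
    and \<epsilon>: "1 / (4 * r) \<le> \<epsilon>" "\<epsilon> \<le> 1 / 2" and pos: "0 < area S T"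
  obtains X Y where "X \<subseteq> S" "Y \<subseteq> T" "2 powr - (2 ^ 80 * (log 2 r + sqrt (\<epsilon> * r))) * area S T \<le> area X Y"
    "\<And>i j. i \<in> X \<Longrightarrow> j \<in> Y \<Longrightarrow> M i j = 0"
proof -
  define L where "L = log 2 r"
  have L: "1 \<le> L"
    using r by (simp add: L_def le_log_iff)
  \<comment> \<open>17/16 pays for the first phase, which keeps 16/17 of the area.\<close>
  define P where "P = 17 / 16 * \<epsilon>"
  define R where "R = sqrt (r * P)"
  have "0 < 1 / (4 * real r)"
    using r by simp
  with \<epsilon> have P: "0 < P" "P \<le> 17 / 32" "1 / (4 * r) \<le> P"
    unfolding P_def by linarith+
  have rP: "1 / 4 \<le> r * P"
    using P r by (simp add: field_simps)
  have R: "R \<le> 2 * sqrt (\<epsilon> * r)"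
  proof -
    have "R \<le> sqrt (4 * (\<epsilon> * r))"
      unfolding R_def P_def using \<epsilon> P by (intro real_sqrt_le_mono) (simp add: P_def)
    also have "\<dots> = 2 * sqrt (\<epsilon> * r)"
      by (simp add: real_sqrt_mult)
    finally show ?thesis .
  qed
  \<comment> \<open>Depends on the entries of the matrix, which is harmless: the first phase may be
    arbitrarily long.\<close>
  define s0 where "s0 = nat \<lceil>block (\<lambda>x. x\<^sup>2) S T / area S T\<rceil>"
  have "block (\<lambda>x. x\<^sup>2) S T / area S T \<le> real s0"
    unfolding s0_def by linarith
  also have "\<dots> \<le> schedule s0"
    by (rule schedule_ge)
  also have "\<dots> \<le> 2 ^ 20 * r * schedule s0"
    using r mult_right_mono[of 1 "2 ^ 20 * real r" "schedule s0"] by simp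
  finally have sq0: "block (\<lambda>x. x\<^sup>2) S T \<le> 2 ^ 20 * r * schedule s0 * area S T"
    using pos by (simp add: divide_le_eq)
  have "block (\<lambda>x. x) S T \<le> 1 / 2 * area S T"
    using mean mult_right_mono[OF \<epsilon>(2) area_nonneg[of S T]] by linarith
  moreover have "(1 - 1 / (17 * 2 ^ s0)) * area S T \<le> 1 * area S T"
    by (intro mult_right_mono) auto
  then have "(1 - 1 / (17 * 2 ^ s0)) * area S T \<le> area S T"
    by simp
  ultimately obtain X1 Y1 where XY1: "X1 \<subseteq> S" "Y1 \<subseteq> T" "16 / 17 * area S T \<le> area X1 Y1"
    "block (\<lambda>x. x\<^sup>2) X1 Y1 \<le> 2 ^ 21 * r * area X1 Y1"
    using bound_second_moment[of S T s0] sq0 by blast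
  have "1 \<le> 2 * L"
    using L by simp
  \<comment> \<open>Makes \<open>2 ^ (2 ^ s2)\<close> at least \<open>r * r\<close>: one
    \<open>r\<close> for the second moment, the other for \<open>1 / P\<close>, up to a factor
    4.\<close>
  then obtain s2 where s2: "2 * L \<le> 2 ^ s2" "2 ^ s2 \<le> 2 * (2 * L)"
    using dyadic_between[of 2 "2 * L"] by auto
  have "block (\<lambda>x. x) X1 Y1 \<le> block (\<lambda>x. x) S T"
    by (rule block_subset_mono) (use XY1 in auto)
  also have "\<dots> \<le> P * (16 / 17 * area S T)"
    using mean by (simp add: P_def)
  also have "\<dots> \<le> P * area X1 Y1"
    using XY1 P by (intro mult_left_mono) auto
  also have "\<dots> \<le> P * (1 + 1 / (16 * 2 ^ s2)) * area X1 Y1"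
    using P by (intro mult_right_mono) auto
  finally have mean1: "block (\<lambda>x. x) X1 Y1 \<le> P * (1 + 1 / (16 * 2 ^ s2)) * area X1 Y1" .
  have sched: "2 ^ 21 * r \<le> 2 ^ 54 * schedule s2 * P"
  proof -
    have "2 powr L = r"
      using r by (simp add: L_def)
    then have "real r * r = 2 powr (2 * L)"
      using powr_add[of 2 L L] by simp
    also have "\<dots> \<le> 2 powr (2 ^ s2)"
      using s2 by (intro powr_mono) auto
    also have "\<dots> = 2 ^ (2 ^ s2)"
      using powr_realpow[of 2 "2 ^ s2"] by simp
    also have "\<dots> \<le> schedule s2"
      unfolding schedule_def using mult_right_mono[of 1 "64 ^ s2" "2 ^ (2 ^ s2) :: real"] by simp
    finally have "real r * r * (1 / (4 * r)) \<le> schedule s2 * P"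
      using P by (intro mult_mono) auto
    then have "real r \<le> 4 * (schedule s2 * P)"
      using r by simp
    moreover have "0 \<le> schedule s2 * P"
      using P by simp
    moreover have "2 ^ 21 * real r \<le> 2 ^ 54 * t" if "real r \<le> 4 * t" "0 \<le> t" for t
      using that by simp
    ultimately have "2 ^ 21 * real r \<le> 2 ^ 54 * (schedule s2 * P)"
      by blast
    then show ?thesis
      by (simp only: mult.assoc of_nat_mult of_nat_power of_nat_numeral)
  qed
  have "block (\<lambda>x. x\<^sup>2) X1 Y1 \<le> 2 ^ 54 * schedule s2 * P * area X1 Y1"
    using XY1(4) mult_right_mono[OF sched area_nonneg[of X1 Y1]] by linarith
  from bound_second_moment_by_density[OF P(1,2) XY1(1,2) mean1 this] obtain X2 Y2
    where XY2: "X2 \<subseteq> S" "Y2 \<subseteq> T"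
      "2 powr - (4 * R * (1 - 1 / 2 ^ s2) + 15 * (2 ^ s2 - 1)) * area X1 Y1 \<le> area X2 Y2"
      "block (\<lambda>x. x) X2 Y2 \<le> 17 / 16 * P * area X2 Y2"
      "block (\<lambda>x. x\<^sup>2) X2 Y2 \<le> 2 ^ 55 * P * area X2 Y2"
    unfolding R_def by blast
  \<comment> \<open>Scaled so that any \<open>B\<close> between \<open>z\<close> and
    \<open>2 ^ 28 * z\<close> fits: \<open>B\<^sup>2 / (4 * r)\<close> dominates the second moment
    \<open>2 ^ 55 * P\<close> and stays below the cap of \<open>bound_nonzeros\<close>, where 17/32
    meets 5/8.\<close>
  define z where "z = 2 ^ 29 * R"
  have z2: "z\<^sup>2 = 2 ^ 58 * (r * P)"
    using rP by (simp add: z_def R_def power_mult_distrib)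
  have "1 / 2 \<le> R"
    unfolding R_def using rP by (intro real_le_rsqrt) (simp add: power2_eq_square)
  then have "1 \<le> z"
    by (simp add: z_def)
  then obtain s3 where s3: "z \<le> (2 ^ 28) ^ s3" "(2 ^ 28) ^ s3 \<le> 2 ^ 28 * z"
    using dyadic_between[of "2 ^ 28" z] by auto
  define B where "B = (2::real) ^ (28 * s3)"
  have "z \<le> B" "B \<le> 2 ^ 28 * z"
    using s3 unfolding B_def power_mult .
  moreover have "2 ^ (56 * s3) = B\<^sup>2"
    by (simp add: B_def power_mult[symmetric])
  ultimately have B: "z \<le> B" "B \<le> 2 ^ 28 * z" "2 ^ (56 * s3) = B\<^sup>2" .
  have "B\<^sup>2 \<le> (2 ^ 28 * z)\<^sup>2"
    using B \<open>1 \<le> z\<close> by (intro power_mono) auto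
  also have "\<dots> = 2 ^ 114 * (r * P)"
    by (simp add: power_mult_distrib z2)
  also have "\<dots> \<le> 2 ^ 114 * (r * (17 / 32))"
    using P by (intro mult_left_mono) auto
  also have "\<dots> \<le> 5 / 8 * 2 ^ 112 * (4 * r)"
    by simp
  finally have upper: "2 ^ (56 * s3) / (4 * r) \<le> (5 / 8 * 2 ^ 112 :: real)"
    unfolding B(3) using r by (simp add: divide_le_eq)
  have "2 ^ 55 * P * (4 * r) \<le> z\<^sup>2"
    using P(1) unfolding z2 by simp
  also have "\<dots> \<le> B\<^sup>2"
    using B \<open>1 \<le> z\<close> by (intro power_mono) auto
  finally have lower: "2 ^ 55 * P \<le> 2 ^ (56 * s3) / (4 * r)"
    unfolding B(3) using r by (simp add: le_divide_eq)
  have sq2: "block (\<lambda>x. x\<^sup>2) X2 Y2 \<le> 2 ^ (56 * s3) / (4 * r) * area X2 Y2"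
    using XY2(5) mult_right_mono[OF lower area_nonneg[of X2 Y2]] by linarith
  have "block (\<lambda>x. of_bool (x \<noteq> 0)) X2 Y2 \<le> block (\<lambda>x. x) X2 Y2"
    by (rule block_mono[OF XY2(1,2)]) auto
  also have "\<dots> \<le> 17 / 16 * P * area X2 Y2"
    by fact
  also have "\<dots> \<le> 5 / 8 * area X2 Y2"
    using P by (intro mult_right_mono) auto
  finally have nz2: "block (\<lambda>x. of_bool (x \<noteq> 0)) X2 Y2 \<le> 5 / 8 * area X2 Y2" .
  from bound_nonzeros[OF XY2(1,2) upper sq2 nz2] obtain X3 Y3
    where XY3: "X3 \<subseteq> S" "Y3 \<subseteq> T" "2 powr - (13000 * B) * area X2 Y2 \<le> area X3 Y3"
      "block (\<lambda>x. of_bool (x \<noteq> 0)) X3 Y3 \<le> 1 / (4 * r) * area X3 Y3"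
    unfolding B_def by blast
  obtain X4 Y4 where XY4: "X4 \<subseteq> S" "Y4 \<subseteq> T" "1 / 4 * area X3 Y3 \<le> area X4 Y4"
    "\<And>i j. i \<in> X4 \<Longrightarrow> j \<in> Y4 \<Longrightarrow> M i j = 0"
    using zero_from_sparse[OF XY3(1,2,4)] by blast
  define e2 where "e2 = 4 * R * (1 - 1 / 2 ^ s2) + 15 * (2 ^ s2 - 1)"
  have "e2 \<le> 4 * R + 60 * L"
  proof -
    have "4 * R * (1 - 1 / 2 ^ s2) \<le> 4 * R * 1"
      using \<open>1 / 2 \<le> R\<close> by (intro mult_left_mono) auto
    with s2 show ?thesis
      by (simp add: e2_def)
  qed
  moreover have "13000 * B \<le> 13000 * (2 ^ 57 * R)"
    using B by (simp add: z_def)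
  moreover have "0 \<le> sqrt (\<epsilon> * r)"
    using R \<open>1 / 2 \<le> R\<close> by linarith
  moreover have "3 + e + 13000 * b \<le> 2 ^ 80 * (l + q)"
    if "e \<le> 4 * x + 60 * l" "13000 * b \<le> 13000 * (2 ^ 57 * x)" "0 \<le> q" "x \<le> 2 * q" "1 \<le> l"
    for e b l q x :: real
    using that by simp
  ultimately have "3 + e2 + 13000 * B \<le> 2 ^ 80 * (L + sqrt (\<epsilon> * r))"
    using R L by blast
  \<comment> \<open>Of the 3 bits, two pay for the final factor 1/4 and one for keeping 16/17,
    weakened to 1/2.\<close>
  then have "2 powr - (2 ^ 80 * (L + sqrt (\<epsilon> * r))) \<le> 2 powr (- 3 + (- e2 + - (13000 * B)))"
    by (intro powr_mono) auto
  also have "\<dots> = 1 / 4 * (2 powr - (13000 * B) * (2 powr - e2 * (1 / 2)))"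
    unfolding powr_add by (simp add: powr_minus)
  finally have "2 powr - (2 ^ 80 * (L + sqrt (\<epsilon> * r))) * area S T \<le>
      1 / 4 * (2 powr - (13000 * B) * (2 powr - e2 * (1 / 2))) * area S T"
    by (intro mult_right_mono) auto
  also have "\<dots> = 1 / 4 * (2 powr - (13000 * B) * (2 powr - e2 * (1 / 2 * area S T)))"
    by (simp only: mult.assoc)
  also have "\<dots> \<le> 1 / 4 * (2 powr - (13000 * B) * (2 powr - e2 * area X1 Y1))"
    using XY1(3) pos by (intro mult_left_mono) auto
  also have "\<dots> \<le> 1 / 4 * (2 powr - (13000 * B) * area X2 Y2)"
    using XY2(3) unfolding e2_def by (intro mult_left_mono) auto
  also have "\<dots> \<le> area X4 Y4"
    using XY3(3) XY4(3) by linarith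
  finally show ?thesis
    using that[of X4 Y4] XY4 unfolding L_def by blast
qed

text \<open>Density below \<open>1 / (4 * r)\<close> needs no iteration, and for
  \<open>r \<ge> 2\<close> the factor 1/4 lost is covered by \<open>log 2 r \<ge> 1\<close>.\<close>

lemma zero_submatrix:
  fixes \<epsilon> :: real
  assumes mean: "block (\<lambda>x. x) S T \<le> \<epsilon> * area S T" and \<epsilon>: "0 \<le> \<epsilon>" "\<epsilon> \<le> 1 / 2"
    and pos: "0 < area S T"
  obtains X Y where "X \<subseteq> S" "Y \<subseteq> T" "2 powr - (2 ^ 80 * (log 2 r + sqrt (\<epsilon> * r))) * area S T \<le> area X Y"
    "\<And>i j. i \<in> X \<Longrightarrow> j \<in> Y \<Longrightarrow> M i j = 0"
proof -
  consider "r = 1" | "r \<ge> 2" "\<epsilon> \<le> 1 / (4 * r)" | "r \<ge> 2" "1 / (4 * r) \<le> \<epsilon>"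
    using r_pos by linarith
  then show ?thesis
  proof cases
    case 1
    define x where "x = sqrt \<epsilon>"
    have "x \<le> 3 / 4"
      unfolding x_def using \<epsilon> by (intro real_le_lsqrt) (auto simp: power2_eq_square)
    with \<epsilon> have x: "0 \<le> x" "x \<le> 3 / 4"
      by (simp_all add: x_def)
    have "2 powr - (2 ^ 80 * x) \<le> 1 - x"
    proof -
      have "ln 2 \<ge> (1 / 2 :: real)"
        using ln_le_minus_one[of "1 / 2 :: real"] by (simp add: ln_div)
      then have "4 * x \<le> 2 ^ 80 * x * ln 2"
        using x mult_mono[of 4 "2 ^ 80 * ln 2 :: real" x x] by (simp add: mult_ac)
      moreover have "1 + 2 ^ 80 * x * ln 2 \<le> exp (2 ^ 80 * x * ln 2)"
        by (rule exp_ge_add_one_self)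
      ultimately have "1 + 4 * x \<le> exp (2 ^ 80 * x * ln 2)"
        by linarith
      also have "\<dots> = 2 powr (2 ^ 80 * x)"
        by (simp add: powr_def)
      finally have "1 + 4 * x \<le> 2 powr (2 ^ 80 * x)" .
      then have "(1 + 4 * x) * (1 - x) \<le> 2 powr (2 ^ 80 * x) * (1 - x)"
        using x by (intro mult_right_mono) auto
      \<comment> \<open>The product is \<open>1 + x * (3 - 4 * x)\<close>, which is why
        \<open>x \<le> 3 / 4\<close> was established.\<close>
      moreover have "1 \<le> (1 + 4 * x) * (1 - x)"
        using mult_left_mono[OF x(2,1)] by (simp add: algebra_simps)
      ultimately have "1 \<le> 2 powr (2 ^ 80 * x) * (1 - x)"
        by linarith
      then show ?thesis
        by (simp add: powr_minus inverse_eq_divide divide_le_eq mult.commute)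
    qed
    then have *: "2 powr - (2 ^ 80 * (log 2 r + sqrt (\<epsilon> * r))) * area S T \<le> (1 - sqrt \<epsilon>) * area S T"
      unfolding x_def using 1 by (intro mult_right_mono) auto
    obtain X Y where "X \<subseteq> S" "Y \<subseteq> T" "(1 - sqrt \<epsilon>) * area S T \<le> area X Y"
      "\<And>i j. i \<in> X \<Longrightarrow> j \<in> Y \<Longrightarrow> M i j = 0"
      using rank_one_zero_submatrix[OF 1 mean \<epsilon>(1)] by blast
    then show ?thesis
      using that[of X Y] * by (meson order_trans)
  next
    case 2
    have "block (\<lambda>x. of_bool (x \<noteq> 0)) S T \<le> block (\<lambda>x. x) S T"
      by (rule block_mono) auto
    also have "\<dots> \<le> 1 / (4 * r) * area S T"
      using mean mult_right_mono[OF 2(2) area_nonneg[of S T]] by linarith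
    finally obtain X Y where XY: "X \<subseteq> S" "Y \<subseteq> T" "1 / 4 * area S T \<le> area X Y"
      "\<And>i j. i \<in> X \<Longrightarrow> j \<in> Y \<Longrightarrow> M i j = 0"
      using zero_from_sparse[OF subset_refl subset_refl] by blast
    have "1 \<le> log 2 r"
      using 2 by (simp add: le_log_iff)
    then have "2 * 1 \<le> 2 ^ 80 * (log 2 r + sqrt (\<epsilon> * r))"
      using \<epsilon> by (intro mult_mono) (auto intro: add_increasing2)
    then have "2 powr - (2 ^ 80 * (log 2 r + sqrt (\<epsilon> * r))) \<le> 2 powr (- 2)"
      by (intro powr_mono) auto
    also have "\<dots> = (1 / 4 :: real)"
      by (simp add: powr_minus)
    finally have "2 powr - (2 ^ 80 * (log 2 r + sqrt (\<epsilon> * r))) * area S T \<le> 1 / 4 * area S T"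
      by (intro mult_right_mono) auto
    then show ?thesis
      using that[of X Y] XY by (meson order_trans)
  next
    case 3
    show ?thesis
      by (rule zero_submatrix_dense[OF 3(1) mean 3(2) \<epsilon>(2) pos]) (blast intro: that)
  qed
qed

end

theorem theorem1p12:
  shows "\<exists>C::real. C > 0 \<and>
    (\<forall>(m::nat) (n::nat) (r::nat) (\<epsilon>::real) (M::real mat).
       M \<in> carrier_mat m n \<longrightarrow>
       vec_space.rank m M = r \<longrightarrow> r \<ge> 1 \<longrightarrow>
       (\<forall>i<m. \<forall>j<n. M $$ (i, j) \<ge> 0 \<and> M $$ (i, j) \<notin> {0<..<1}) \<longrightarrow>
       mat_average M = \<epsilon> \<longrightarrow> \<epsilon> \<le> 1 / 2 \<longrightarrow>
       (\<exists>I J. I \<subseteq> {..<m} \<and> J \<subseteq> {..<n} \<and>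
          submatrix M I J = 0\<^sub>m (card I) (card J) \<and>
          real (card I) \<ge> 2 powr (- C * (log 2 (real r) + sqrt (\<epsilon> * real r))) * real m \<and>
          real (card J) \<ge> 2 powr (- C * (log 2 (real r) + sqrt (\<epsilon> * real r))) * real n))"
proof (intro exI[of _ "2 ^ 80"] conjI allI impI)
  show "(0::real) < 2 ^ 80"
    by simp
next
  fix m n r :: nat and \<epsilon> :: real and M :: "real mat"
  assume M: "M \<in> carrier_mat m n" and rank: "vec_space.rank m M = r" and r: "r \<ge> 1"
    and entries: "\<forall>i<m. \<forall>j<n. M $$ (i, j) \<ge> 0 \<and> M $$ (i, j) \<notin> {0<..<1}"
    and avg: "mat_average M = \<epsilon>" and half: "\<epsilon> \<le> 1 / 2"
  define \<theta> where "\<theta> = 2 powr (- (2 ^ 80) * (log 2 (real r) + sqrt (\<epsilon> * real r)))"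
  have \<epsilon>: "\<epsilon> = (\<Sum>i<m. \<Sum>j<n. M $$ (i, j)) / (real m * real n)"
    using avg M by (simp add: mat_average_def)
  have \<epsilon>0: "0 \<le> \<epsilon>"
    unfolding \<epsilon> using entries by (intro divide_nonneg_nonneg sum_nonneg) auto
  have "0 \<le> log 2 (real r) + sqrt (\<epsilon> * real r)"
    using r \<epsilon>0 by simp
  then have "\<theta> \<le> 2 powr 0"
    unfolding \<theta>_def by (intro powr_mono) (auto simp: mult_nonpos_nonneg)
  then have \<theta>: "\<theta> \<le> 1"
    by simp
  have "\<exists>I J. I \<subseteq> {..<m} \<and> J \<subseteq> {..<n} \<and> (\<forall>i\<in>I. \<forall>j\<in>J. M $$ (i, j) = 0) \<and>
    \<theta> * m \<le> card I \<and> \<theta> * n \<le> card J"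
  proof (cases "m = 0 \<or> n = 0")
    case True
    have "\<theta> * m \<le> 1 * real m" "\<theta> * n \<le> 1 * real n"
      using \<theta> by (intro mult_right_mono; simp)+
    with True show ?thesis
      \<comment> \<open>With one index set empty, the full index sets satisfy the zero condition
        vacuously.\<close>
      by (intro exI[of _ "{..<m}"] exI[of _ "{..<n}"]) auto
  next
    case False
    interpret sparse_low_rank "\<lambda>i j. M $$ (i, j)" "{..<m}" "{..<n}" r
    proof
      show "M $$ (i, j) = 0 \<or> 1 \<le> M $$ (i, j)" if "i \<in> {..<m}" "j \<in> {..<n}" for i j
        using entries that by fastforce
    qed (use rank_le_matrix_rank[OF M] rank r in auto)
    have "block (\<lambda>x. x) {..<m} {..<n} \<le> \<epsilon> * area {..<m} {..<n}" "0 < area {..<m} {..<n}"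
      using False by (simp_all add: \<epsilon> block_def area_def)
    then obtain I J where IJ: "I \<subseteq> {..<m}" "J \<subseteq> {..<n}"
      "2 powr - (2 ^ 80 * (log 2 r + sqrt (\<epsilon> * r))) * area {..<m} {..<n} \<le> area I J"
      "\<And>i j. i \<in> I \<Longrightarrow> j \<in> J \<Longrightarrow> M $$ (i, j) = 0"
      using zero_submatrix[OF _ \<epsilon>0 half] by blast
    \<comment> \<open>A bound on the product suffices: neither side can exceed its full length, so
      each must retain the proportion \<open>\<theta>\<close>.\<close>
    have area: "\<theta> * (real m * real n) \<le> real (card I) * real (card J)"
      using IJ(3) by (simp add: \<theta>_def area_def)
    have I: "card I \<le> m" and J: "card J \<le> n"
      using card_mono[OF _ IJ(1)] card_mono[OF _ IJ(2)] by simp_all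
    have "real (card I) * real (card J) \<le> real (card I) * real n"
      using J by (intro mult_left_mono) auto
    with area have "(\<theta> * real m) * real n \<le> real (card I) * real n"
      by (simp add: mult.assoc)
    then have "\<theta> * m \<le> card I"
      using False by simp
    moreover have "real (card I) * real (card J) \<le> real m * real (card J)"
      using I by (intro mult_right_mono) auto
    with area have "real m * (\<theta> * real n) \<le> real m * real (card J)"
      by (simp add: mult_ac)
    then have "\<theta> * n \<le> card J"
      using False by simp
    ultimately show ?thesis
      using IJ by blast
  qed
  then obtain I J where IJ: "I \<subseteq> {..<m}" "J \<subseteq> {..<n}" "\<forall>i\<in>I. \<forall>j\<in>J. M $$ (i, j) = 0"
    "\<theta> * m \<le> card I" "\<theta> * n \<le> card J"
    by blast
  moreover have "submatrix M I J = 0\<^sub>m (card I) (card J)"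
    using IJ by (intro submatrix_eq_zero[OF M]) auto
  ultimately show "\<exists>I J. I \<subseteq> {..<m} \<and> J \<subseteq> {..<n} \<and>
          submatrix M I J = 0\<^sub>m (card I) (card J) \<and>
          real (card I) \<ge> 2 powr (- (2 ^ 80) * (log 2 (real r) + sqrt (\<epsilon> * real r))) * real m \<and>
          real (card J) \<ge> 2 powr (- (2 ^ 80) * (log 2 (real r) + sqrt (\<epsilon> * real r))) * real n"
    unfolding \<theta>_def by blast
qed

end
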